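(* There is a polynomial-space (many-one) reduction from $\mathrm{Reach(VASS)}$ into $\mathrm{SAT}(\mathrm{PLRV})$.
   Context: Logic LRV: fix a countably infinite set $\mathrm{VAR}$ of variables. Formulas are $\varphi ::= \mathtt{x} \approx \mathsf{X}^i \mathtt{y} \mid \mathtt{x} \approx \langle \varphi ? \rangle \mathtt{y} \mid \mathtt{x} \not\approx \langle \varphi ? \rangle \mathtt{y} \mid \varphi \wedge \varphi \mid \neg \varphi \mid \mathsf{X}\varphi \mid \varphi \mathsf{U} \varphi \mid \mathsf{X}^{-1}\varphi \mid \varphi \mathsf{S} \varphi$ with $\mathtt{x},\mathtt{y}\in\mathrm{VAR}$, $i\in\mathbb{N}$. A model is a finite non-empty sequence $\sigma=\sigma(0)\cdots\sigma(|\sigma|-1)$ of valuations $\mathrm{VAR}\to\mathbb{N}$. For $0\le i<|\sigma|$: $\sigma,i\models \mathtt{x}\approx\mathsf{X}^j\mathtt{y}$ iff $i+j<|\sigma|$ and $\sigma(i)(\mathtt{x})=\sigma(i+j)(\mathtt{y})$; $\sigma,i\models \mathtt{x}\approx\langle\varphi?\rangle\mathtt{y}$ iff there is $j$ with $i<j<|\sigma|$, $\sigma(i)(\mathtt{x})=\sigma(j)(\mathtt{y})$ and $\sigma,j\models\varphi$; $\mathtt{x}\not\approx\langle\varphi?\rangle\mathtt{y}$ is the same with $\sigma(i)(\mathtt{x})\neq\sigma(j)(\mathtt{y})$; Boolean connectives as usual; $\sigma,i\models\mathsf{X}\varphi$ iff $i+1<|\sigma|$ and $\sigma,i+1\models\varphi$;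 $\sigma,i\models\mathsf{X}^{-1}\varphi$ iff $i>0$ and $\sigma,i-1\models\varphi$; $\sigma,i\models\varphi\mathsf{U}\psi$ iff there is $i\le j<|\sigma|$ with $\sigma,j\models\psi$ and $\sigma,l\models\varphi$ for all $i\le l<j$; $\sigma,i\models\varphi\mathsf{S}\psi$ iff there is $0\le j\le i$ with $\sigma,j\models\psi$ and $\sigma,l\models\varphi$ for all $j<l\le i$. A formula $\varphi$ is satisfiable iff $\sigma,0\models\varphi$ for some model $\sigma$. PLRV extends LRV with atomic formulas $\mathtt{x}\approx\langle\varphi?\rangle^{-1}\mathtt{y}$ and $\mathtt{x}\not\approx\langle\varphi?\rangle^{-1}\mathtt{y}$: $\sigma,i\models\mathtt{x}\approx\langle\varphi?\rangle^{-1}\mathtt{y}$ iff there is $0\le j<i$ with $\sigma(i)(\mathtt{x})=\sigma(j)(\mathtt{y})$ and $\sigma,j\models\varphi$ (resp. $\neq$ for $\not\approx$). $\mathrm{SAT}(\mathrm{PLRV})$ is the problem of deciding whether a given PLRV formula is satisfiable. A vector addition system with states (VASS) is a tuple $(Q,C,\delta)$ with $Q$ a finite set of control states, $C$ a finite set of counters and $\delta\subseteq Q\times\mathbb{Z}^C\times Q$ finite. Configurations are pairs $(q,\vec v)\in Q\times\mathbb{N}^C$, and $(q,\vec v)\to(q',\vec v')$ iff there is $(q,\vec u,q')\in\delta$ with $\vec v'=\vec v+\vec u$. $\mathrm{Reach(VASS)}$: given a VASS and two configurations $(q_0,\vec v_0)$, $(q_f,\vec v_f)$, decide whether $(q_f,\vec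 v_f)$ is reachable from $(q_0,\vec v_0)$ by $\to^*$. *)

theory Defs
  imports "HOL-Computational_Algebra.Polynomial"
begin

datatype dir = MoveL | Stay | MoveR

fun move :: "dir \<Rightarrow> nat \<Rightarrow> nat" where
  "move MoveL h = h - 1"
| "move Stay h = h"
| "move MoveR h = Suc h"

datatype 'i cell = LeftEnd | InSym 'i | RightEnd

text \<open>
  Deterministic multi-tape Turing machines with a two-way read-only input tape over the finite
  alphabet \<open>'i\<close>, \<open>ntapes\<close> one-way infinite work tapes, and a write-only output
  tape over the finite alphabet \<open>'o\<close>. Control states are the numbers below
  \<open>nstates\<close>, work symbols the numbers below \<open>nsyms\<close>; state \<open>0\<close>
  is initial and symbol \<open>0\<close> is the blank.
  The transition function takes the control state, the scanned input cell and the list of scanned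
  work symbols; it returns the next state, the move of the input head, the written symbol and the
  head move for every work tape, and possibly one symbol appended to the output.
\<close>

record ('i, 'o) transducer =
  nstates :: nat
  nsyms :: nat
  ntapes :: nat
  final :: "nat set"
  delta :: "nat \<Rightarrow> 'i cell \<Rightarrow> nat list \<Rightarrow> nat \<times> dir \<times> (nat \<times> dir) list \<times> 'o option"

definition transducer :: "('i::finite, 'o::finite) transducer \<Rightarrow> bool" where
  "transducer M \<longleftrightarrow> 0 < nstates M \<and> 0 < nsyms M \<and>
     (\<forall>q < nstates M. \<forall>a. \<forall>ss. length ss = ntapes M \<and> (\<forall>s\<in>set ss. s < nsyms M) \<longrightarrow>
        (case delta M q a ss of (q', d, acts, w) \<Rightarrow>
           q' < nstates M \<and> length acts = ntapes M \<and> (\<forall>(s, e)\<in>set acts. s < nsyms M)))"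

record 'o tmconf =
  ctrl :: nat
  inpos :: nat
  tapes :: "((nat \<Rightarrow> nat) \<times> nat) list"  \<comment> \<open>contents and head position of each work tape\<close>
  outp :: "'o list"

definition init_conf :: "('i, 'o) transducer \<Rightarrow> 'o tmconf" where
  "init_conf M = \<lparr>ctrl = 0, inpos = 0, tapes = replicate (ntapes M) (\<lambda>_. 0, 0), outp = []\<rparr>"

text \<open>
  The input word occupies the positions \<open>1, \<dots>, length x\<close> between two end markers, and
  the input head never leaves the range \<open>0, \<dots>, length x + 1\<close>: otherwise its position
  would be an unbounded counter not accounted for in the space.
\<close>

definition scan_input :: "'i list \<Rightarrow> nat \<Rightarrow> 'i cell" where
  "scan_input x p = (if p = 0 then LeftEnd else if p \<le> length x then InSym (x ! (p - 1)) else RightEnd)"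

definition act :: "(nat \<Rightarrow> nat) \<times> nat \<Rightarrow> nat \<times> dir \<Rightarrow> (nat \<Rightarrow> nat) \<times> nat" where
  "act = (\<lambda>(T, h) (s, d). (T(h := s), move d h))"

definition tm_step :: "('i, 'o) transducer \<Rightarrow> 'i list \<Rightarrow> 'o tmconf \<Rightarrow> 'o tmconf" where
  "tm_step M x c =
     (if ctrl c \<in> final M then c
      else case delta M (ctrl c) (scan_input x (inpos c)) (map (\<lambda>(T, h). T h) (tapes c)) of
        (q', d, acts, w) \<Rightarrow>
          \<lparr>ctrl = q',
           inpos = min (length x + 1) (move d (inpos c)),
           tapes = map2 act (tapes c) acts,
           outp = outp c @ (case w of None \<Rightarrow> [] | Some b \<Rightarrow> [b])\<rparr>)"

definition tm_run :: "('i, 'o) transducer \<Rightarrow> 'i list \<Rightarrow> nat \<Rightarrow> 'o tmconf" where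
  "tm_run M x t = (tm_step M x ^^ t) (init_conf M)"

text \<open>
  Only work-tape cells count towards the space. In particular the output may be longer than
  the space bound.
\<close>

definition computes_in_space :: "('i, 'o) transducer \<Rightarrow> nat \<Rightarrow> 'i list \<Rightarrow> 'o list \<Rightarrow> bool" where
  "computes_in_space M s x y \<longleftrightarrow>
     (\<exists>t. ctrl (tm_run M x t) \<in> final M \<and> outp (tm_run M x t) = y) \<and>
     (\<forall>t. \<forall>(T, h)\<in>set (tapes (tm_run M x t)). h < s)"

record ('a, 's) problem =
  instances :: "'a set"
  positive :: "'a set"
  encode :: "'a \<Rightarrow> 's list"

definition polyspace_reduction ::
  "('a, 'i::finite) problem \<Rightarrow> ('b, 'o::finite) problem \<Rightarrow> ('a \<Rightarrow> 'b) \<Rightarrow> bool" where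
  "polyspace_reduction A B f \<longleftrightarrow>
     (\<forall>a\<in>instances A. f a \<in> instances B \<and> (a \<in> positive A \<longleftrightarrow> f a \<in> positive B)) \<and>
     (\<exists>M p. transducer M \<and>
        (\<forall>a\<in>instances A.
           computes_in_space M (poly p (length (encode A a))) (encode A a) (encode B (f a))))"

definition polyspace_reducible ::
  "('a, 'i::finite) problem \<Rightarrow> ('b, 'o::finite) problem \<Rightarrow> bool" where
  "polyspace_reducible A B \<longleftrightarrow> (\<exists>f. polyspace_reduction A B f)"

text \<open>Binary notation, least significant bit first and without superfluous zeros.\<close>

fun bin :: "nat \<Rightarrow> bool list" where
  "bin n = (if n = 0 then [] else odd n # bin (n div 2))"

declare bin.simps [simp del]

text \<open>Vectors indexed by a finite set \<open>C\<close> are functions that vanish outside \<open>C\<close>.\<close>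

record ('q, 'c) vass =
  control :: "'q set"
  counters :: "'c set"
  trans :: "('q \<times> ('c \<Rightarrow> int) \<times> 'q) set"

definition vass :: "('q, 'c) vass \<Rightarrow> bool" where
  "vass V \<longleftrightarrow> finite (control V) \<and> finite (counters V) \<and> finite (trans V) \<and>
     trans V \<subseteq> control V \<times> {u. \<forall>c. c \<notin> counters V \<longrightarrow> u c = 0} \<times> control V"

definition vass_confs :: "('q, 'c) vass \<Rightarrow> ('q \<times> ('c \<Rightarrow> nat)) set" where
  "vass_confs V = control V \<times> {v. \<forall>c. c \<notin> counters V \<longrightarrow> v c = 0}"

definition vass_step ::
  "('q, 'c) vass \<Rightarrow> 'q \<times> ('c \<Rightarrow> nat) \<Rightarrow> 'q \<times> ('c \<Rightarrow> nat) \<Rightarrow> bool" where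
  "vass_step V = (\<lambda>(q, v) (q', v').
     (q, v) \<in> vass_confs V \<and> (q', v') \<in> vass_confs V \<and>
     (\<exists>u. (q, u, q') \<in> trans V \<and> (\<forall>c\<in>counters V. int (v' c) = int (v c) + u c)))"

text \<open>
  To be written down, a VASS is presented with control states \<open>0, \<dots>, inst_states - 1\<close>,
  counters \<open>0, \<dots>, inst_dim - 1\<close> and a list of transitions.
\<close>

record vass_inst =
  inst_states :: nat
  inst_dim :: nat
  inst_source :: "nat \<times> nat list"
  inst_target :: "nat \<times> nat list"
  inst_trans :: "(nat \<times> int list \<times> nat) list"

definition vec_of :: "'a::zero list \<Rightarrow> nat \<Rightarrow> 'a" where
  "vec_of xs i = (if i < length xs then xs ! i else 0)"

definition vass_of :: "vass_inst \<Rightarrow> (nat, nat) vass" where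
  "vass_of I = \<lparr>control = {..<inst_states I}, counters = {..<inst_dim I},
     trans = (\<lambda>(q, u, q'). (q, vec_of u, q')) ` set (inst_trans I)\<rparr>"

definition conf_of :: "nat \<times> nat list \<Rightarrow> nat \<times> (nat \<Rightarrow> nat)" where
  "conf_of = map_prod id vec_of"

definition vass_instances :: "vass_inst set" where
  "vass_instances = {I. vass (vass_of I) \<and>
     conf_of (inst_source I) \<in> vass_confs (vass_of I) \<and>
     conf_of (inst_target I) \<in> vass_confs (vass_of I) \<and>
     length (snd (inst_source I)) = inst_dim I \<and> length (snd (inst_target I)) = inst_dim I \<and>
     (\<forall>(q, u, q')\<in>set (inst_trans I). length u = inst_dim I)}"

datatype vsym = VBit bool | VMinus | VMark | VEnd

instance vsym :: finite
proof
  have "a \<in> range VBit \<union> {VMinus, VMark, VEnd}" for a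
    by (cases a) simp_all
  then have "(UNIV :: vsym set) \<subseteq> range VBit \<union> {VMinus, VMark, VEnd}"
    by blast
  then show "finite (UNIV :: vsym set)"
    by (rule finite_subset) simp
qed

definition enc_nat :: "nat \<Rightarrow> vsym list" where
  "enc_nat n = map VBit (bin n) @ [VEnd]"

definition enc_int :: "int \<Rightarrow> vsym list" where
  "enc_int z = (if z < 0 then [VMinus] else []) @ enc_nat (nat \<bar>z\<bar>)"

text \<open>
  State names and all vector entries are in binary. The numbers of control states and of counters are
  in unary, since the finite sets \<open>Q\<close> and \<open>C\<close> are part of the input.
\<close>

definition enc_vass :: "vass_inst \<Rightarrow> vsym list" where
  "enc_vass I =
     replicate (inst_states I) VMark @ [VEnd] @ replicate (inst_dim I) VMark @ [VEnd] @
     (case inst_source I of (q, v) \<Rightarrow> enc_nat q @ concat (map enc_nat v)) @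
     (case inst_target I of (q, v) \<Rightarrow> enc_nat q @ concat (map enc_nat v)) @
     concat (map (\<lambda>(q, u, q'). VMark # enc_nat q @ concat (map enc_int u) @ enc_nat q')
       (inst_trans I))"

definition Reach_VASS :: "(vass_inst, vsym) problem" where
  "Reach_VASS = \<lparr>instances = vass_instances,
     positive = {I \<in> vass_instances.
       (vass_step (vass_of I))\<^sup>*\<^sup>* (conf_of (inst_source I)) (conf_of (inst_target I))},
     encode = enc_vass\<rparr>"

type_synonym var = nat

datatype plrv =
    EqX var nat var            \<comment> \<open>\<open>x \<approx> X\<^sup>i y\<close>\<close>
  | EqFut var plrv var         \<comment> \<open>\<open>x \<approx> \<langle>\<phi>?\<rangle> y\<close>\<close>
  | NeqFut var plrv var        \<comment> \<open>\<open>x \<notapprox> \<langle>\<phi>?\<rangle> y\<close>\<close>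
  | EqPast var plrv var        \<comment> \<open>\<open>x \<approx> \<langle>\<phi>?\<rangle>\<^sup>-\<^sup>1 y\<close>\<close>
  | NeqPast var plrv var       \<comment> \<open>\<open>x \<notapprox> \<langle>\<phi>?\<rangle>\<^sup>-\<^sup>1 y\<close>\<close>
  | And plrv plrv
  | Neg plrv
  | Next plrv
  | Until plrv plrv
  | Prev plrv
  | Since plrv plrv

type_synonym model = "(var \<Rightarrow> nat) list"

text \<open>Only meaningful for non-empty \<open>\<sigma>\<close> and positions \<open>i < length \<sigma>\<close>.\<close>

primrec holds :: "model \<Rightarrow> nat \<Rightarrow> plrv \<Rightarrow> bool" where
  "holds \<sigma> i (EqX x k y) \<longleftrightarrow> i + k < length \<sigma> \<and> (\<sigma> ! i) x = (\<sigma> ! (i + k)) y"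
| "holds \<sigma> i (EqFut x \<phi> y) \<longleftrightarrow>
     (\<exists>j. i < j \<and> j < length \<sigma> \<and> (\<sigma> ! i) x = (\<sigma> ! j) y \<and> holds \<sigma> j \<phi>)"
| "holds \<sigma> i (NeqFut x \<phi> y) \<longleftrightarrow>
     (\<exists>j. i < j \<and> j < length \<sigma> \<and> (\<sigma> ! i) x \<noteq> (\<sigma> ! j) y \<and> holds \<sigma> j \<phi>)"
| "holds \<sigma> i (EqPast x \<phi> y) \<longleftrightarrow> (\<exists>j < i. (\<sigma> ! i) x = (\<sigma> ! j) y \<and> holds \<sigma> j \<phi>)"
| "holds \<sigma> i (NeqPast x \<phi> y) \<longleftrightarrow> (\<exists>j < i. (\<sigma> ! i) x \<noteq> (\<sigma> ! j) y \<and> holds \<sigma> j \<phi>)"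
| "holds \<sigma> i (And \<phi> \<psi>) \<longleftrightarrow> holds \<sigma> i \<phi> \<and> holds \<sigma> i \<psi>"
| "holds \<sigma> i (Neg \<phi>) \<longleftrightarrow> \<not> holds \<sigma> i \<phi>"
| "holds \<sigma> i (Next \<phi>) \<longleftrightarrow> i + 1 < length \<sigma> \<and> holds \<sigma> (i + 1) \<phi>"
| "holds \<sigma> i (Until \<phi> \<psi>) \<longleftrightarrow>
     (\<exists>j. i \<le> j \<and> j < length \<sigma> \<and> holds \<sigma> j \<psi> \<and> (\<forall>l. i \<le> l \<and> l < j \<longrightarrow> holds \<sigma> l \<phi>))"
| "holds \<sigma> i (Prev \<phi>) \<longleftrightarrow> i > 0 \<and> holds \<sigma> (i - 1) \<phi>"
| "holds \<sigma> i (Since \<phi> \<psi>) \<longleftrightarrow>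
     (\<exists>j \<le> i. holds \<sigma> j \<psi> \<and> (\<forall>l. j < l \<and> l \<le> i \<longrightarrow> holds \<sigma> l \<phi>))"

definition satisfiable :: "plrv \<Rightarrow> bool" where
  "satisfiable \<phi> \<longleftrightarrow> (\<exists>\<sigma>. \<sigma> \<noteq> [] \<and> holds \<sigma> 0 \<phi>)"

datatype fsym =
    FEqX | FEqFut | FNeqFut | FEqPast | FNeqPast | FAnd | FNeg | FNext | FUntil | FPrev | FSince
  | FBit bool | FEnd

instance fsym :: finite
proof
  have "a \<in> range FBit \<union>
      {FEqX, FEqFut, FNeqFut, FEqPast, FNeqPast, FAnd, FNeg, FNext, FUntil, FPrev, FSince, FEnd}" for a
    by (cases a) simp_all
  then have "(UNIV :: fsym set) \<subseteq> range FBit \<union>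
      {FEqX, FEqFut, FNeqFut, FEqPast, FNeqPast, FAnd, FNeg, FNext, FUntil, FPrev, FSince, FEnd}"
    by blast
  then show "finite (UNIV :: fsym set)"
    by (rule finite_subset) simp
qed

definition enc_var :: "var \<Rightarrow> fsym list" where
  "enc_var x = map FBit (bin x) @ [FEnd]"

text \<open>Formulas are written in prefix notation; \<open>X\<^sup>i\<close> is \<open>i\<close> copies of \<open>X\<close>.\<close>

primrec enc_plrv :: "plrv \<Rightarrow> fsym list" where
  "enc_plrv (EqX x k y) = FEqX # enc_var x @ replicate k FNext @ enc_var y"
| "enc_plrv (EqFut x \<phi> y) = FEqFut # enc_var x @ enc_plrv \<phi> @ enc_var y"
| "enc_plrv (NeqFut x \<phi> y) = FNeqFut # enc_var x @ enc_plrv \<phi> @ enc_var y"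
| "enc_plrv (EqPast x \<phi> y) = FEqPast # enc_var x @ enc_plrv \<phi> @ enc_var y"
| "enc_plrv (NeqPast x \<phi> y) = FNeqPast # enc_var x @ enc_plrv \<phi> @ enc_var y"
| "enc_plrv (And \<phi> \<psi>) = FAnd # enc_plrv \<phi> @ enc_plrv \<psi>"
| "enc_plrv (Neg \<phi>) = FNeg # enc_plrv \<phi>"
| "enc_plrv (Next \<phi>) = FNext # enc_plrv \<phi>"
| "enc_plrv (Until \<phi> \<psi>) = FUntil # enc_plrv \<phi> @ enc_plrv \<psi>"
| "enc_plrv (Prev \<phi>) = FPrev # enc_plrv \<phi>"
| "enc_plrv (Since \<phi> \<psi>) = FSince # enc_plrv \<phi> @ enc_plrv \<psi>"

definition SAT_PLRV :: "(plrv, fsym) problem" where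
  "SAT_PLRV = \<lparr>instances = UNIV, positive = {\<phi>. satisfiable \<phi>}, encode = enc_plrv\<rparr>"

end

theory Submission
  imports Defs "HOL-Library.Countable"
begin

text \<open>
  A VASS is turned into a Petri net: the control state is a token, and counter \<open>c\<close> is the weighted
  sum over \<open>k\<close> of \<open>2^k\<close> times the number of tokens of name \<open>(c, k)\<close>. A binary vector is then a
  set of tokens, and the tokens of a counter can be rearranged at will by splitting a token of level
  \<open>k + 1\<close> into two of level \<open>k\<close> or merging two back. A model of the formula is a word that lists the
  increments and decrements of a run, transition by transition, ending with the removal of the target
  configuration; each increment spells the name of its token in the following letters. The data
  values match increments with decrements: increments carry distinct data, so do decrements, every
  decrement repeats the datum of an earlier increment with its name, and the datum of every increment
  recurs at a later decrement. Hence every prefix has as many increments as decrements of each name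
  or more, and the whole word has equally many.

  The formula is essentially a letter-by-letter translation of the input, so that a two-way machine
  with four counters bounded by the input length can write it.
\<close>

section \<open>Counter programs on Turing machines\<close>

text \<open>Tokens of weight one alone would not do: a vector entry \<open>2^k\<close> would cost
  exponentially many events in the formula, whereas levels cost one event per binary digit. The
  price is that a configuration has many markings, and a transition may ask for a token of a level
  that is empty although the counter is large enough. Soundness is blind to this, since it only
  tracks the weighted sums, which splits and merges preserve. Completeness needs that any two
  markings of one configuration are connected: every split adds a token while the weighted sum
  bounds their number, so splitting ends with all tokens at level 0, and merges retrace such a path
  backwards. As a level may hold any number of tokens, finitely many levels serve counters that are
  unbounded along a run.

  Only the variables 0 to 3 occur, whatever the input: variable 0 carries the data, and its
  equalities with 1, 2 and 3 spell the letters. Unboundedly many names therefore have to be written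
  out as words. Removing the target at the end turns exact reachability into an empty final balance,
  so that a partner can be demanded for every increment.\<close>

datatype ('i, 'r) test = Cell "'i cell set" | Pos 'r

datatype ('i, 'r, 'o) com =
    Skip
  | Write 'o
  | Go dir
  | Up 'r
  | Down 'r
  | Seq "('i, 'r, 'o) com" "('i, 'r, 'o) com"  (infixr ";;" 60)
  | Cond "('i, 'r) test" "('i, 'r, 'o) com" "('i, 'r, 'o) com"
  | While "('i, 'r) test" "('i, 'r, 'o) com"

fun passes :: "'i list \<Rightarrow> nat \<Rightarrow> ('r \<Rightarrow> nat) \<Rightarrow> ('i, 'r) test \<Rightarrow> bool" where
  "passes x p cs (Cell A) \<longleftrightarrow> scan_input x p \<in> A"
| "passes x p cs (Pos r) \<longleftrightarrow> 0 < cs r"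

text \<open>The bound \<open>B\<close> is enforced at \<open>Up\<close>, the sole command that
  enlarges a counter. Existence of a derivation thus certifies termination and the space bound
  together.\<close>

inductive exec :: "'i list \<Rightarrow> nat \<Rightarrow> ('i, 'r, 'o) com \<Rightarrow>
    nat \<times> ('r \<Rightarrow> nat) \<times> 'o list \<Rightarrow> nat \<times> ('r \<Rightarrow> nat) \<times> 'o list \<Rightarrow> bool"
  for x B where
  Skip: "exec x B Skip s s"
| Write: "exec x B (Write y) (p, cs, out) (p, cs, out @ [y])"
| Go: "exec x B (Go d) (p, cs, out) (min (length x + 1) (move d p), cs, out)"
| Up: "cs r < B \<Longrightarrow> exec x B (Up r) (p, cs, out) (p, cs(r := Suc (cs r)), out)"
| Down: "exec x B (Down r) (p, cs, out) (p, cs(r := cs r - 1), out)"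
| Seq: "exec x B c1 s1 s2 \<Longrightarrow> exec x B c2 s2 s3 \<Longrightarrow> exec x B (c1 ;; c2) s1 s3"
| CondT: "passes x p cs t \<Longrightarrow> exec x B c1 (p, cs, out) s \<Longrightarrow> exec x B (Cond t c1 c2) (p, cs, out) s"
| CondF: "\<not> passes x p cs t \<Longrightarrow> exec x B c2 (p, cs, out) s \<Longrightarrow> exec x B (Cond t c1 c2) (p, cs, out) s"
| WhileT: "passes x p cs t \<Longrightarrow> exec x B c (p, cs, out) s \<Longrightarrow> exec x B (While t c) s s' \<Longrightarrow>
    exec x B (While t c) (p, cs, out) s'"
| WhileF: "\<not> passes x p cs t \<Longrightarrow> exec x B (While t c) (p, cs, out) (p, cs, out)"

text \<open>Tests enter as a predicate \<open>b\<close>, so that the same function runs on true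
  counter values in \<open>mstep\<close> and on scanned tape symbols in
  \<open>compile\<close>.\<close>

fun ctl :: "('i, 'r, 'o) com list \<Rightarrow> (('i, 'r) test \<Rightarrow> bool) \<Rightarrow>
    ('i, 'r, 'o) com list \<times> dir \<times> ('r \<Rightarrow> dir) \<times> 'o option" where
  "ctl [] b = ([], Stay, \<lambda>_. Stay, None)"
| "ctl (Skip # K) b = (K, Stay, \<lambda>_. Stay, None)"
| "ctl (Write y # K) b = (K, Stay, \<lambda>_. Stay, Some y)"
| "ctl (Go d # K) b = (K, d, \<lambda>_. Stay, None)"
| "ctl (Up r # K) b = (K, Stay, (\<lambda>_. Stay)(r := MoveR), None)"
| "ctl (Down r # K) b = (K, Stay, (\<lambda>_. Stay)(r := MoveL), None)"
| "ctl ((c1 ;; c2) # K) b = (c1 # c2 # K, Stay, \<lambda>_. Stay, None)"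
| "ctl (Cond t c1 c2 # K) b = ((if b t then c1 else c2) # K, Stay, \<lambda>_. Stay, None)"
| "ctl (While t c # K) b = (if b t then c # While t c # K else K, Stay, \<lambda>_. Stay, None)"

definition mstep :: "'i list \<Rightarrow> ('i, 'r, 'o) com list \<times> nat \<times> ('r \<Rightarrow> nat) \<times> 'o list \<Rightarrow>
    ('i, 'r, 'o) com list \<times> nat \<times> ('r \<Rightarrow> nat) \<times> 'o list" where
  "mstep x = (\<lambda>(K, p, cs, out). case ctl K (passes x p cs) of (K', d, e, w) \<Rightarrow>
     (K', min (length x + 1) (move d p), \<lambda>r. move (e r) (cs r),
      out @ (case w of None \<Rightarrow> [] | Some b \<Rightarrow> [b])))"

definition inbounds :: "'i list \<Rightarrow> nat \<Rightarrow> nat \<times> ('r \<Rightarrow> nat) \<times> 'o list \<Rightarrow> bool" where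
  "inbounds x B = (\<lambda>(p, cs, out). p \<le> Suc (length x) \<and> (\<forall>r. cs r \<le> B))"

definition bstep where
  "bstep x B s s' \<longleftrightarrow> s' = mstep x s \<and> inbounds x B (snd s')"

lemma bstepI: "mstep x s = s' \<Longrightarrow> inbounds x B (snd s') \<Longrightarrow> bstep x B s s'"
  by (simp add: bstep_def)

text \<open>Every stack \<open>K\<close> below the command is allowed: inside a sequence or a loop,
  the induction hypothesis is applied with the remaining work pushed onto \<open>K\<close>.\<close>

lemma exec_bsteps:
  assumes "exec x B c s s'" "inbounds x B s"
  shows "inbounds x B s' \<and> (\<forall>K. (bstep x B)\<^sup>*\<^sup>* (c # K, s) (K, s'))"
  using assms
proof induction
  case (Skip s)
  have "bstep x B (Skip # K, s) (K, s)" for K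
    using Skip by (intro bstepI) (auto simp: mstep_def inbounds_def)
  with Skip show ?case by blast
next
  case (Write y p cs out)
  have "bstep x B (Write y # K, p, cs, out) (K, p, cs, out @ [y])" for K
    using Write by (intro bstepI) (auto simp: mstep_def inbounds_def)
  with Write show ?case by (simp add: inbounds_def r_into_rtranclp)
next
  case (Go d p cs out)
  have "bstep x B (Go d # K, p, cs, out) (K, min (length x + 1) (move d p), cs, out)" for K
    using Go by (intro bstepI) (auto simp: mstep_def inbounds_def)
  with Go show ?case by (simp add: inbounds_def r_into_rtranclp)
next
  case (Up cs r p out)
  then have "bstep x B (Up r # K, p, cs, out) (K, p, cs(r := Suc (cs r)), out)" for K
    by (intro bstepI) (auto simp: mstep_def inbounds_def fun_eq_iff)
  with Up show ?case by (simp add: inbounds_def r_into_rtranclp)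
next
  case (Down r p cs out)
  have le: "cs r - 1 \<le> B"
    using Down by (auto simp: inbounds_def intro: le_trans[OF diff_le_self])
  with Down have "bstep x B (Down r # K, p, cs, out) (K, p, cs(r := cs r - 1), out)" for K
    by (intro bstepI) (auto simp: mstep_def inbounds_def fun_eq_iff)
  with Down le show ?case by (simp add: inbounds_def r_into_rtranclp)
next
  case (Seq c1 s1 s2 c2 s3)
  have "bstep x B ((c1 ;; c2) # K, s1) (c1 # c2 # K, s1)" for K
    using Seq.prems by (intro bstepI) (auto simp: mstep_def inbounds_def)
  with Seq show ?case by (meson converse_rtranclp_into_rtranclp rtranclp_trans)
next
  case (CondT p cs t c1 out s c2)
  then have "bstep x B (Cond t c1 c2 # K, p, cs, out) (c1 # K, p, cs, out)" for K
    by (intro bstepI) (auto simp: mstep_def inbounds_def)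
  with CondT show ?case by (meson converse_rtranclp_into_rtranclp)
next
  case (CondF p cs t c2 out s c1)
  then have "bstep x B (Cond t c1 c2 # K, p, cs, out) (c2 # K, p, cs, out)" for K
    by (intro bstepI) (auto simp: mstep_def inbounds_def)
  with CondF show ?case by (meson converse_rtranclp_into_rtranclp)
next
  case (WhileT p cs t c out s s')
  then have "bstep x B (While t c # K, p, cs, out) (c # While t c # K, p, cs, out)" for K
    by (intro bstepI) (auto simp: mstep_def inbounds_def)
  with WhileT show ?case by (meson converse_rtranclp_into_rtranclp rtranclp_trans)
next
  case (WhileF p cs t c out)
  then have "bstep x B (While t c # K, p, cs, out) (K, p, cs, out)" for K
    by (intro bstepI) (auto simp: mstep_def inbounds_def)
  with WhileF show ?case by (simp add: r_into_rtranclp)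
qed

lemma bsteps_funpow:
  assumes "(bstep x B)\<^sup>*\<^sup>* s s'" "inbounds x B (snd s)"
  shows "\<exists>t. (mstep x ^^ t) s = s' \<and> (\<forall>u\<le>t. inbounds x B (snd ((mstep x ^^ u) s)))"
  using assms
proof induction
  case base
  then show ?case by (intro exI[of _ 0]) auto
next
  case (step s' s'')
  then obtain t where t: "(mstep x ^^ t) s = s'" "\<forall>u\<le>t. inbounds x B (snd ((mstep x ^^ u) s))"
    by blast
  with step.hyps show ?case
    by (intro exI[of _ "Suc t"]) (auto simp: bstep_def le_Suc_eq)
qed

lemma mstep_stuck: "p \<le> Suc (length x) \<Longrightarrow> mstep x ([], p, cs, out) = ([], p, cs, out)"
  by (simp add: mstep_def)

text \<open>The control states of the compiled machine are the continuations that can arise from a program.\<close>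

fun conts :: "('i, 'r, 'o) com \<Rightarrow> ('i, 'r, 'o) com list \<Rightarrow> ('i, 'r, 'o) com list set" where
  "conts (c1 ;; c2) K = insert ((c1 ;; c2) # K) (conts c1 (c2 # K) \<union> conts c2 K)"
| "conts (Cond t c1 c2) K = insert (Cond t c1 c2 # K) (conts c1 K \<union> conts c2 K)"
| "conts (While t c) K = insert (While t c # K) (conts c (While t c # K))"
| "conts c K = {c # K}"

lemma finite_conts: "finite (conts c K)"
  by (induction c K rule: conts.induct) auto

lemma conts_self: "c # K \<in> conts c K"
  by (cases c) auto

text \<open>A step stays among the continuations of \<open>c\<close> or pops down to
  \<open>K\<close>. With \<open>K = []\<close> this closes the finite set of control states under
  steps.\<close>

lemma conts_closed: "K' \<in> conts c K \<Longrightarrow> fst (ctl K' b) \<in> insert K (conts c K)"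
proof (induction c K rule: conts.induct)
  case (1 c1 c2 K)
  then show ?case using conts_self[of c1 "c2 # K"] conts_self[of c2 K] by auto
next
  case (2 t c1 c2 K)
  then show ?case using conts_self[of c1 K] conts_self[of c2 K] by auto
next
  case (3 t c K)
  then show ?case using conts_self[of c "While t c # K"] by (cases "b t") auto
qed auto

section \<open>Compilation into a transducer\<close>

definition mark_tape :: "nat \<Rightarrow> nat" where
  "mark_tape = (\<lambda>_. 0)(0 := 1)"

definition sensed :: "'r list \<Rightarrow> 'i cell \<Rightarrow> nat list \<Rightarrow> ('i, 'r) test \<Rightarrow> bool" where
  "sensed rs a ss t = (case t of Cell A \<Rightarrow> a \<in> A | Pos r \<Rightarrow> map_of (zip rs ss) r \<noteq> Some 1)"

text \<open>
  A counter is the head position of a work tape whose only non-blank symbol marks cell 0; state 0 of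
  the compiled machine writes these marks.
\<close>

definition compile :: "'r list \<Rightarrow> (('i, 'r, 'o) com list \<Rightarrow> nat) \<Rightarrow> ('i, 'r, 'o) com list set \<Rightarrow>
    ('i, 'r, 'o) com \<Rightarrow> ('i, 'o) transducer" where
  "compile rs h S c = \<lparr>nstates = Suc (card S), nsyms = 2, ntapes = length rs, final = {Suc (h [])},
     delta = (\<lambda>q a ss.
       if q = 0 then (Suc (h [c]), Stay, replicate (length rs) (1, Stay), None)
       else case ctl (inv_into S h (q - 1)) (sensed rs a ss) of (K, d, e, w) \<Rightarrow> (Suc (h K), d, map2 (\<lambda>r s. (s, e r)) rs ss, w))\<rparr>"

definition tm_of :: "'r list \<Rightarrow> (('i, 'r, 'o) com list \<Rightarrow> nat) \<Rightarrow>
    ('i, 'r, 'o) com list \<times> nat \<times> ('r \<Rightarrow> nat) \<times> 'o list \<Rightarrow> 'o tmconf" where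
  "tm_of rs h = (\<lambda>(K, p, cs, out).
     \<lparr>ctrl = Suc (h K), inpos = p, tapes = map (\<lambda>r. (mark_tape, cs r)) rs, outp = out\<rparr>)"

context
  fixes c :: "('i::finite, 'r::finite, 'o::finite) com"
    and rs :: "'r list" and S :: "('i, 'r, 'o) com list set" and h :: "('i, 'r, 'o) com list \<Rightarrow> nat"
  assumes S: "S = insert [] (conts c [])"
    and h: "bij_betw h S {..<card S}"
    and rs: "distinct rs" "set rs = UNIV"
begin

lemma S_closed: "K \<in> S \<Longrightarrow> fst (ctl K b) \<in> S"
  using conts_closed[of K c "[]" b] by (auto simp: S)

lemma h_less: "K \<in> S \<Longrightarrow> h K < card S"
  using h by (auto simp: bij_betw_def)

lemma transducer_compile: "transducer (compile rs h S c)"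
proof -
  have c: "[c] \<in> S" using conts_self[of c "[]"] by (simp add: S)
  have K: "inv_into S h (q - 1) \<in> S" if "0 < q" "q < Suc (card S)" for q
    using that h by (intro inv_into_into) (auto simp: bij_betw_def)
  show ?thesis
    unfolding transducer_def compile_def
    using c h_less S_closed[OF K]
    by (auto simp: split_beta prod_eq_iff dest: set_zip_rightD split: prod.splits)
qed

lemma tm_step_compile:
  assumes "K \<in> S" "p \<le> Suc (length x)"
  shows "tm_step (compile rs h S c) x (tm_of rs h (K, p, cs, out)) =
    tm_of rs h (mstep x (K, p, cs, out))"
proof (cases "K = []")
  case True
  with assms show ?thesis by (simp add: tm_step_def tm_of_def mstep_def compile_def)
next
  case False
  have inj: "inj_on h S" using h by (simp add: bij_betw_def)
  have "h K \<noteq> h []"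
    using inj assms(1) False by (auto simp: S inj_on_def)
  moreover have "inv_into S h (h K) = K"
    using inj assms(1) by simp
  moreover have "map_of (zip rs (map (\<lambda>r. mark_tape (cs r)) rs)) r = Some (mark_tape (cs r))" for r
    using rs by (simp add: map_of_zip_map)
  \<comment> \<open>A head scans the mark exactly when its counter is 0, so the scanned symbols
    decide every test.\<close>
  then have "sensed rs (scan_input x p) (map (\<lambda>r. mark_tape (cs r)) rs) = passes x p cs"
    by (auto simp: sensed_def fun_eq_iff mark_tape_def split: test.splits)
  \<comment> \<open>Each head writes back the symbol it scanned, so the marks survive.\<close>
  moreover have "map2 act (map (\<lambda>r. (mark_tape, cs r)) rs)
      (map2 (\<lambda>r s. (s, e r)) rs (map (\<lambda>r. mark_tape (cs r)) rs)) =
      map (\<lambda>r. (mark_tape, move (e r) (cs r))) rs" for e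
    by (induction rs) (auto simp: act_def)
  ultimately show ?thesis
    by (auto simp: tm_step_def tm_of_def mstep_def compile_def split_beta comp_def)
qed

lemma computes_compile:
  assumes "exec x B c (0, \<lambda>_. 0, []) (p, cs, y)"
  shows "computes_in_space (compile rs h S c) (Suc B) x y"
proof -
  let ?M = "compile rs h S c" and ?s = "([c], 0, \<lambda>_. 0, [])"
  have *: "inbounds x B (0, \<lambda>_::'r. 0, []::'o list)"
    by (simp add: inbounds_def)
  from exec_bsteps[OF assms *] have p: "inbounds x B (p, cs, y)"
    and "(bstep x B)\<^sup>*\<^sup>* ?s ([], p, cs, y)" by auto
  from bsteps_funpow[OF this(2)] * obtain t where t: "(mstep x ^^ t) ?s = ([], p, cs, y)"
    and le: "\<forall>u\<le>t. inbounds x B (snd ((mstep x ^^ u) ?s))" by auto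
  \<comment> \<open>The space bound speaks of all times, hence also of those after halting.\<close>
  have after: "(mstep x ^^ (u + t)) ?s = ([], p, cs, y)" for u
    using p by (induction u) (auto simp: t mstep_stuck inbounds_def)
  have inb: "inbounds x B (snd ((mstep x ^^ u) ?s))" for u
    using le p after[of "u - t"] by (cases "u \<le> t") auto
  have inS: "fst ((mstep x ^^ u) ?s) \<in> S" for u
  proof (induction u)
    case 0
    then show ?case using conts_self[of c "[]"] by (simp add: S)
  next
    case (Suc u)
    obtain K p cs out where "(mstep x ^^ u) ?s = (K, p, cs, out)" by (metis prod_cases4)
    with Suc S_closed[of K "passes x p cs"] show ?case
      by (auto simp: mstep_def split: prod.splits)
  qed
  have "map2 act (map (\<lambda>_. (\<lambda>_. 0, 0)) rs) (map (\<lambda>_. (1, Stay)) rs) = map (\<lambda>_. (mark_tape, 0)) rs"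
    by (induction rs) (auto simp: act_def mark_tape_def)
  then have first: "tm_step ?M x (init_conf ?M) = tm_of rs h ?s"
    by (simp add: tm_step_def init_conf_def compile_def tm_of_def map_replicate_const)
  \<comment> \<open>The first machine step writes the marks, whence the shift by one.\<close>
  have run: "tm_run ?M x (Suc u) = tm_of rs h ((mstep x ^^ u) ?s)" for u
  proof (induction u)
    case 0
    then show ?case using first by (simp add: tm_run_def)
  next
    case (Suc u)
    obtain K p cs out where s: "(mstep x ^^ u) ?s = (K, p, cs, out)" by (metis prod_cases4)
    have "tm_run ?M x (Suc (Suc u)) = tm_step ?M x (tm_run ?M x (Suc u))"
      by (simp add: tm_run_def)
    also have "\<dots> = tm_of rs h (mstep x (K, p, cs, out))"
      using inS[of u] inb[of u] unfolding Suc s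
      by (intro tm_step_compile) (auto simp: inbounds_def)
    finally show ?case by (simp add: s)
  qed
  have "ctrl (tm_run ?M x (Suc t)) \<in> final ?M \<and> outp (tm_run ?M x (Suc t)) = y"
    unfolding run t by (simp add: tm_of_def compile_def)
  moreover have "\<forall>(T, h) \<in> set (tapes (tm_run ?M x u)). h < Suc B" for u
  proof (cases u)
    case 0
    then show ?thesis by (auto simp: tm_run_def init_conf_def)
  next
    case (Suc u')
    obtain K p cs out where "(mstep x ^^ u') ?s = (K, p, cs, out)" by (metis prod_cases4)
    with inb[of u'] show ?thesis
      by (auto simp: Suc run tm_of_def inbounds_def less_Suc_eq_le)
  qed
  ultimately show ?thesis unfolding computes_in_space_def by blast
qed

end

theorem compile_correct:
  fixes c :: "('i::finite, 'r::finite, 'o::finite) com"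
  shows "\<exists>M :: ('i, 'o) transducer. transducer M \<and>
    (\<forall>x B p cs y. exec x B c (0, \<lambda>_. 0, []) (p, cs, y) \<longrightarrow> computes_in_space M (Suc B) x y)"
proof -
  define S where "S = insert [] (conts c [])"
  have "finite S" by (simp add: S_def finite_conts)
  then obtain h where "bij_betw h S {..<card S}"
    using ex_bij_betw_finite_nat[of S] by (auto simp: atLeast0LessThan)
  moreover obtain rs :: "'r list" where "set rs = UNIV" "distinct rs"
    using finite_distinct_list[of "UNIV :: 'r set"] by auto
  ultimately show ?thesis
    using transducer_compile[OF S_def] computes_compile[OF S_def] by blast
qed

section \<open>The formula\<close>

datatype letter = Bit bool | Sep | Stop | Inc | Dec | Blk

text \<open>Flag number \<open>i\<close> tells whether variable \<open>i\<close> agrees with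
  variable 0. Three flags are the fewest that tell seven letters apart.\<close>

fun flags :: "letter \<Rightarrow> bool \<times> bool \<times> bool" where
  "flags (Bit b) = (True, True, b)"
| "flags Sep = (True, False, True)"
| "flags Stop = (True, False, False)"
| "flags Inc = (False, True, True)"
| "flags Dec = (False, True, False)"
| "flags Blk = (False, False, False)"

lemma flags_eq_iff [simp]: "flags a = flags b \<longleftrightarrow> a = b"
  by (cases a; cases b) auto

definition tt :: plrv where "tt = EqX 0 0 0"

definition flag :: "var \<Rightarrow> bool \<Rightarrow> plrv" where
  "flag i b = (if b then EqX 0 0 i else Neg (EqX 0 0 i))"

definition lit :: "letter \<Rightarrow> plrv" where
  "lit a = (case flags a of (f, g, h) \<Rightarrow> And (flag 1 f) (And (flag 2 g) (flag 3 h)))"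

text \<open>The closing letter must be neither \<open>Inc\<close> nor \<open>Dec\<close>, to leave
  the balance alone, nor \<open>Blk\<close>, which would demand yet another block.\<close>

definition end_pos :: plrv where "end_pos = And (lit Stop) (Neg (Next tt))"

primrec spell :: "letter list \<Rightarrow> plrv \<Rightarrow> plrv" where
  "spell [] \<psi> = \<psi>"
| "spell (a # as) \<psi> = And (lit a) (Next (spell as \<psi>))"

datatype name = St nat | Ct nat nat

text \<open>Names are written the way the program finds them: states are copied digit by digit from
  the input, while counter and level stand in registers and are printed in unary.
  \<open>Stop\<close> makes the code prefix-free; \<open>Sep\<close> tells counter tokens from state
  tokens.\<close>

fun word :: "name \<Rightarrow> letter list" where
  "word (St q) = map Bit (bin q) @ [Stop]"
| "word (Ct c k) = replicate c (Bit False) @ [Sep] @ replicate k (Bit False) @ [Stop]"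

type_synonym event = "bool \<times> name"

definition produced :: "name \<Rightarrow> plrv" where
  "produced w = spell (Inc # word w) tt"

text \<open>
  Only increments spell the name of their token. A decrement carries the datum of an earlier increment
  instead, which determines the name.
\<close>

fun chain :: "plrv \<Rightarrow> event list \<Rightarrow> plrv" where
  "chain \<tau> [] = \<tau>"
| "chain \<tau> ((True, w) # es) = spell (Inc # word w) (chain \<tau> es)"
| "chain \<tau> ((False, w) # es) = And (lit Dec) (And (EqPast 0 (produced w) 0) (Next (chain \<tau> es)))"

definition never :: "plrv \<Rightarrow> plrv" where
  "never \<phi> = Neg (Until tt \<phi>)"

definition inc_once :: plrv where "inc_once = never (And (lit Inc) (EqFut 0 (lit Inc) 0))"
definition dec_once :: plrv where "dec_once = never (And (lit Dec) (EqFut 0 (lit Dec) 0))"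
definition inc_used :: plrv where "inc_used = never (And (lit Inc) (Neg (EqFut 0 (lit Dec) 0)))"

text \<open>A negated disjunction, in a form in which every alternative contributes a string of its
  own to the encoding, each after the same prefix \<open>alt_str\<close>.\<close>

primrec none_next :: "plrv list \<Rightarrow> plrv" where
  "none_next [] = tt"
| "none_next (\<phi> # \<phi>s) = And (Neg (Next \<phi>)) (none_next \<phi>s)"

fun num_events :: "bool \<Rightarrow> nat \<Rightarrow> nat \<Rightarrow> bool list \<Rightarrow> event list" where
  "num_events s c k [] = []"
| "num_events s c k (b # bs) = (if b then [(s, Ct c k)] else []) @ num_events s c (Suc k) bs"

fun vec_events :: "nat \<Rightarrow> (bool \<times> nat) list \<Rightarrow> event list" where
  "vec_events c [] = []"
| "vec_events c ((s, n) # ns) = num_events s c 0 (bin n) @ vec_events (Suc c) ns"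

definition signed :: "int \<Rightarrow> bool \<times> nat" where
  "signed z = (0 \<le> z, nat \<bar>z\<bar>)"

definition conf_events :: "bool \<Rightarrow> nat \<times> nat list \<Rightarrow> event list" where
  "conf_events s = (\<lambda>(q, v). (s, St q) # vec_events 0 (map (Pair s) v))"

text \<open>The state token is consumed first, so that soundness can read off the control state from
  the balance right after it.\<close>

definition trans_events :: "nat \<times> int list \<times> nat \<Rightarrow> event list" where
  "trans_events = (\<lambda>(q, u, q'). (False, St q) # vec_events 0 (map signed u) @ [(True, St q')])"

definition split_events :: "nat \<Rightarrow> nat \<Rightarrow> event list" where
  "split_events c k = [(False, Ct c (Suc k)), (True, Ct c k), (True, Ct c k)]"

definition merge_events :: "nat \<Rightarrow> nat \<Rightarrow> event list" where
  "merge_events c k = [(False, Ct c k), (False, Ct c k), (True, Ct c (Suc k))]"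

text \<open>To be used with \<open>N\<close> the input length, which bounds the number of counters
  and of digits alike and can be measured by the program. The lists are reversed because the program
  counts its registers down.\<close>

definition carry_events :: "nat \<Rightarrow> event list list" where
  "carry_events N = concat (map (\<lambda>c. concat (map (\<lambda>k. [split_events c k, merge_events c k])
     (rev [0..<N]))) (rev [0..<N]))"

definition choices :: "vass_inst \<Rightarrow> event list list" where
  "choices I = map trans_events (inst_trans I) @ carry_events (length (enc_vass I))"

text \<open>The last conjunct denies a \<open>Blk\<close> followed by none of the alternatives. So
  after each \<open>Blk\<close> comes either a choice that leads to a further \<open>Blk\<close> or
  the removal of the target that leads to the end of the word.\<close>

definition run_formula :: "vass_inst \<Rightarrow> plrv" where
  "run_formula I = And inc_once (And dec_once (And inc_used
     (And (chain (lit Blk) (conf_events True (inst_source I)))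
       (never (And (lit Blk) (none_next (chain end_pos (conf_events False (inst_target I)) #
         map (chain (lit Blk)) (choices I))))))))"

lemma set_carry_events:
  "es \<in> set (carry_events N) \<longleftrightarrow>
     (\<exists>c<N. \<exists>k<N. es = split_events c k \<or> es = merge_events c k)"
  by (auto simp: carry_events_def Bex_def)

section \<open>A program that writes the formula\<close>

definition letter_str :: "letter \<Rightarrow> fsym list" where
  "letter_str a = FAnd # enc_plrv (lit a) @ [FNext]"

text \<open>For a decrement, \<open>pre_str\<close> opens the \<open>EqPast\<close> formula that
  \<open>post_str\<close> closes again. Variable 0 has no binary digits, so a lone
  \<open>FEnd\<close> encodes it.\<close>

definition pre_str :: "bool \<Rightarrow> fsym list" where
  "pre_str s = (if s then [] else FAnd # enc_plrv (lit Dec) @ [FAnd, FEqPast, FEnd]) @ letter_str Inc"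

definition post_str :: "bool \<Rightarrow> fsym list" where
  "post_str s = (if s then [] else enc_plrv tt @ [FEnd, FNext])"

definition event_str :: "event \<Rightarrow> fsym list" where
  "event_str = (\<lambda>(s, w). pre_str s @ concat (map letter_str (word w)) @ post_str s)"

definition events_str :: "event list \<Rightarrow> fsym list" where
  "events_str es = concat (map event_str es)"

lemma events_str_simps [simp]:
  "events_str [] = []" "events_str (e # es) = event_str e @ events_str es"
  "events_str (es @ fs) = events_str es @ events_str fs"
  by (simp_all add: events_str_def)

definition alt_str :: "fsym list" where "alt_str = [FAnd, FNeg, FNext]"

definition choice_str :: "event list \<Rightarrow> fsym list" where
  "choice_str es = alt_str @ events_str es @ enc_plrv (lit Blk)"

definition head_str :: "fsym list" where
  "head_str = FAnd # enc_plrv inc_once @ FAnd # enc_plrv dec_once @ FAnd # enc_plrv inc_used @ [FAnd]"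

definition mid_str :: "fsym list" where
  "mid_str = [FNeg, FUntil] @ enc_plrv tt @ FAnd # enc_plrv (lit Blk)"

lemma enc_spell: "enc_plrv (spell as \<psi>) = concat (map letter_str as) @ enc_plrv \<psi>"
  by (induction as) (auto simp: letter_str_def)

text \<open>In prefix notation the rest of the chain is always the last argument, so no closing
  symbols pile up and the events can be written one after another without a stack.\<close>

lemma enc_chain: "enc_plrv (chain \<tau> es) = events_str es @ enc_plrv \<tau>"
proof (induction \<tau> es rule: chain.induct)
  case (3 \<tau> w es)
  then show ?case
    by (simp add: event_str_def pre_str_def post_str_def produced_def enc_spell enc_var_def bin.simps
        del: spell.simps)
qed (auto simp: event_str_def pre_str_def post_str_def enc_spell simp del: spell.simps)

lemma enc_none_next:
  "enc_plrv (none_next \<phi>s) = concat (map (\<lambda>\<phi>. alt_str @ enc_plrv \<phi>) \<phi>s) @ enc_plrv tt"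
  by (induction \<phi>s) (auto simp: alt_str_def)

lemma enc_run_formula:
  "enc_plrv (run_formula I) = head_str @ events_str (conf_events True (inst_source I)) @
     enc_plrv (lit Blk) @ mid_str @ alt_str @ events_str (conf_events False (inst_target I)) @
     enc_plrv end_pos @ concat (map (\<lambda>t. choice_str (trans_events t)) (inst_trans I)) @
     concat (map choice_str (carry_events (length (enc_vass I)))) @ enc_plrv tt"
  by (simp add: run_formula_def head_str_def mid_str_def never_def[of "And (lit Blk) _"] enc_chain
      enc_none_next choices_def comp_def choice_str_def[abs_def] alt_str_def)

section \<open>Output and register idioms\<close>

primrec emits :: "'o list \<Rightarrow> ('i, 'r, 'o) com" where
  "emits [] = Skip"
| "emits (y # ys) = Write y ;; emits ys"

lemma exec_emits: "exec x B (emits ys) (p, cs, out) (p, cs, out @ ys)"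
proof (induction ys arbitrary: out)
  case (Cons y ys)
  then show ?case using exec.Seq[OF exec.Write Cons.IH[of "out @ [y]"]] by simp
qed (simp add: exec.Skip)

text \<open>Lets the final configuration be inferred by unification from the rules of
  \<open>exec\<close>, to be compared with the intended one only afterwards.\<close>

lemma exec_eq: "exec x B c s s' \<Longrightarrow> s' = s'' \<Longrightarrow> exec x B c s s''"
  by simp

definition shift :: "'r \<Rightarrow> 'r \<Rightarrow> 'o list \<Rightarrow> ('i, 'r, 'o) com" where
  "shift a b ys = While (Pos a) (emits ys ;; Down a ;; Up b)"

lemma exec_shift:
  assumes "a \<noteq> b" "cs a + cs b \<le> B"
  shows "exec x B (shift a b ys) (p, cs, out)
    (p, cs(a := 0, b := cs a + cs b), out @ concat (replicate (cs a) ys))"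
  using assms
proof (induction "cs a" arbitrary: cs out)
  case 0
  then have "cs(a := 0, b := 0 + cs b) = cs" by (auto simp: fun_eq_iff)
  with 0 show ?case unfolding shift_def by (auto intro!: exec_eq[OF exec.WhileF])
next
  case (Suc n)
  let ?cs = "cs(a := n, b := Suc (cs b))"
  have "exec x B (emits ys ;; Down a ;; Up b) (p, cs, out) (p, cs(a := cs a - 1, b := Suc ((cs(a := cs a - 1)) b)), out @ ys)"
    using Suc by (intro exec.Seq[OF exec_emits] exec.Seq[OF exec.Down] exec.Up) auto
  then have 1: "exec x B (emits ys ;; Down a ;; Up b) (p, cs, out) (p, ?cs, out @ ys)"
    using Suc.prems by (simp add: Suc.hyps(2)[symmetric])
  have 2: "exec x B (shift a b ys) (p, ?cs, out @ ys)
      (p, ?cs(a := 0, b := ?cs a + ?cs b), (out @ ys) @ concat (replicate (?cs a) ys))"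
    using Suc.prems Suc.hyps(2) by (intro Suc.hyps(1)) auto
  have "?cs(a := 0, b := ?cs a + ?cs b) = cs(a := 0, b := cs a + cs b)"
    using Suc.prems Suc.hyps(2) by (auto simp: fun_eq_iff)
  with exec.WhileT[OF _ 1 2[unfolded shift_def]] show ?case
    using Suc.prems Suc.hyps(2)[symmetric] by (simp add: shift_def)
qed

text \<open>\<open>RC\<close> holds the index of the current counter, \<open>RK\<close> the level,
  \<open>RT\<close> is scratch, and \<open>RR\<close> holds the number of vector entries still to be
  read.\<close>

datatype reg = RC | RK | RT | RR

instance reg :: finite
proof
  have "a \<in> {RC, RK, RT, RR}" for a
    by (cases a) simp_all
  then have "(UNIV :: reg set) \<subseteq> {RC, RK, RT, RR}"
    by blast
  then show "finite (UNIV :: reg set)"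
    by (rule finite_subset) simp
qed

definition regs :: "nat \<Rightarrow> nat \<Rightarrow> nat \<Rightarrow> nat \<Rightarrow> reg \<Rightarrow> nat" where
  "regs c k t r a = (case a of RC \<Rightarrow> c | RK \<Rightarrow> k | RT \<Rightarrow> t | RR \<Rightarrow> r)"

lemma regs_simps [simp]:
  "regs c k t r RC = c" "regs c k t r RK = k" "regs c k t r RT = t" "regs c k t r RR = r"
  by (simp_all add: regs_def)

lemma regs_upd [simp]:
  "(regs c k t r)(RC := n) = regs n k t r"
  "(regs c k t r)(RK := n) = regs c n t r"
  "(regs c k t r)(RT := n) = regs c k n r"
  "(regs c k t r)(RR := n) = regs c k t n"
  by (auto simp: fun_eq_iff regs_def split: reg.split)

text \<open>The second, silent shift restores \<open>a\<close> after it has been counted down for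
  printing.\<close>

definition tally :: "reg \<Rightarrow> 'o list \<Rightarrow> ('i, reg, 'o) com" where
  "tally a ys = shift a RT ys ;; shift RT a []"

lemma exec_tally:
  "c \<le> B \<Longrightarrow> exec x B (tally RC ys) (p, regs c k 0 r, out)
     (p, regs c k 0 r, out @ concat (replicate c ys))"
  "k \<le> B \<Longrightarrow> exec x B (tally RK ys) (p, regs c k 0 r, out)
     (p, regs c k 0 r, out @ concat (replicate k ys))"
proof -
  have *: "exec x B (tally a ys) (p, cs, out) (p, cs, out @ concat (replicate (cs a) ys))"
    if "a \<noteq> RT" "cs RT = 0" "cs a \<le> B" for a cs
  proof -
    let ?cs = "cs(a := 0, RT := cs a + cs RT)"
    from that have "exec x B (tally a ys) (p, cs, out)
        (p, ?cs(RT := 0, a := ?cs RT + ?cs a), (out @ concat (replicate (cs a) ys)) @ concat (replicate (?cs RT) []))"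
      unfolding tally_def by (intro exec.Seq[OF exec_shift exec_shift]) auto
    moreover have "?cs(RT := 0, a := ?cs RT + ?cs a) = cs"
      using that by (auto simp: fun_eq_iff)
    ultimately show ?thesis by simp
  qed
  show "c \<le> B \<Longrightarrow> exec x B (tally RC ys) (p, regs c k 0 r, out)
     (p, regs c k 0 r, out @ concat (replicate c ys))"
    using *[of RC "regs c k 0 r"] by simp
  show "k \<le> B \<Longrightarrow> exec x B (tally RK ys) (p, regs c k 0 r, out)
     (p, regs c k 0 r, out @ concat (replicate k ys))"
    using *[of RK "regs c k 0 r"] by simp
qed

section \<open>Programs for tokens, numbers, vectors and states\<close>

definition event_prog :: "bool \<Rightarrow> ('i, reg, fsym) com" where
  "event_prog s = emits (pre_str s) ;; tally RC (letter_str (Bit False)) ;; emits (letter_str Sep) ;;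
     tally RK (letter_str (Bit False)) ;; emits (letter_str Stop @ post_str s)"

lemma exec_event:
  assumes "c \<le> B" "k \<le> B"
  shows "exec x B (event_prog s) (p, regs c k 0 r, out)
    (p, regs c k 0 r, out @ event_str (s, Ct c k))"
  unfolding event_prog_def
  by (rule exec_eq, (rule exec.Seq exec_emits exec_tally assms)+) (simp add: event_str_def map_replicate)

text \<open>The convention of all reading programs: cell 0 is the left end marker, so with the head
  at \<open>Suc q\<close> the unread input is \<open>drop q x\<close>.\<close>

lemma at_symbol:
  assumes "drop q x = a # ys"
  shows "scan_input x (Suc q) = InSym a" "drop (Suc q) x = ys"
    "exec x B (Go MoveR) (Suc q, cs, out) (Suc (Suc q), cs, out)"
proof -
  have q: "q < length x" using assms by (metis drop_eq_Nil linorder_not_less list.distinct(1))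
  then show "scan_input x (Suc q) = InSym a" "drop (Suc q) x = ys"
    using assms nth_via_drop[OF assms] by (auto simp: scan_input_def drop_Suc tl_drop[symmetric])
  show "exec x B (Go MoveR) (Suc q, cs, out) (Suc (Suc q), cs, out)"
    using q by (intro exec_eq[OF exec.Go]) auto
qed

lemma drop_append: "drop q x = ys @ zs \<Longrightarrow> drop (q + length ys) x = zs"
  by (metis add.commute append_eq_conv_conj drop_drop)

abbreviation digit_cells :: "vsym cell set" where
  "digit_cells \<equiv> {InSym (VBit True), InSym (VBit False)}"

definition digits_prog :: "bool \<Rightarrow> (vsym, reg, fsym) com" where
  "digits_prog s = While (Cell digit_cells)
     (Cond (Cell {InSym (VBit True)}) (event_prog s) Skip ;; Go MoveR ;; Up RK)"

lemma exec_digits: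
  assumes "drop q x = map VBit bs @ VEnd # ys" "c \<le> B" "k + length bs \<le> B"
  shows "exec x B (digits_prog s) (Suc q, regs c k 0 r, out)
    (Suc (q + length bs), regs c (k + length bs) 0 r, out @ events_str (num_events s c k bs))"
  using assms
proof (induction bs arbitrary: q k out)
  case Nil
  then show ?case by (auto simp: digits_prog_def at_symbol intro!: exec_eq[OF exec.WhileF])
next
  case (Cons b bs)
  note at = at_symbol[of q x "VBit b" "map VBit bs @ VEnd # ys"]
  let ?out = "out @ events_str (if b then [(s, Ct c k)] else [])"
  have 1: "exec x B (Cond (Cell {InSym (VBit True)}) (event_prog s) Skip)
      (Suc q, regs c k 0 r, out) (Suc q, regs c k 0 r, ?out)"
  proof (cases b)
    case True
    with Cons.prems show ?thesis by (intro exec.CondT) (auto simp: at intro: exec_event)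
  next
    case False
    with Cons.prems show ?thesis by (intro exec.CondF) (auto simp: at intro: exec.Skip)
  qed
  have 2: "exec x B (Go MoveR ;; Up RK) (Suc q, regs c k 0 r, ?out)
      (Suc (Suc q), regs c (Suc k) 0 r, ?out)"
    using Cons.prems exec.Up[of "regs c k 0 r" RK B x "Suc (Suc q)" ?out]
    by (intro exec.Seq[OF at(3)]) auto
  have 3: "exec x B (digits_prog s) (Suc (Suc q), regs c (Suc k) 0 r, ?out)
      (Suc (Suc q + length bs), regs c (Suc k + length bs) 0 r,
        ?out @ events_str (num_events s c (Suc k) bs))"
    using Cons.prems by (intro Cons.IH) (auto simp: at)
  show ?case
    using Cons.prems
      exec.WhileT[OF _ exec.Seq[OF 1 2] 3[unfolded digits_prog_def]]
    by (cases b) (auto simp: digits_prog_def at)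
qed

definition clear :: "'r \<Rightarrow> ('i, 'r, 'o) com" where
  "clear a = While (Pos a) (Down a)"

lemma exec_clear: "exec x B (clear a) (p, cs, out) (p, cs(a := 0), out)"
proof (induction "cs a" arbitrary: cs)
  case 0
  then have "cs(a := 0) = cs" by (auto simp: fun_eq_iff)
  with 0 show ?case unfolding clear_def by (auto intro!: exec_eq[OF exec.WhileF])
next
  case (Suc n)
  from Suc.hyps(1)[of "cs(a := n)"] Suc.hyps(2)[symmetric]
    exec.WhileT[OF _ exec.Down[of x B a p cs out], of "Pos a" "(p, cs(a := 0), out)"]
  show ?case unfolding clear_def by simp
qed

definition num_prog :: "bool \<Rightarrow> (vsym, reg, fsym) com" where
  "num_prog s = digits_prog s ;; Go MoveR ;; clear RK ;; Up RC ;; Down RR"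

lemma exec_num:
  assumes q: "drop q x = enc_nat n @ ys" and c: "c < length x"
  shows "exec x (length x) (num_prog s) (Suc q, regs c 0 0 r, out)
    (Suc (q + length (enc_nat n)), regs (Suc c) 0 0 (r - 1), out @ events_str (num_events s c 0 (bin n)))"
proof -
  have "length (bin n) \<le> length (drop q x)" unfolding q enc_nat_def by simp
  also have "\<dots> \<le> length x" by simp
  finally have n: "length (bin n) \<le> length x" .
  have 1: "exec x (length x) (digits_prog s) (Suc q, regs c 0 0 r, out)
    (Suc (q + length (bin n)), regs c (0 + length (bin n)) 0 r, out @ events_str (num_events s c 0 (bin n)))"
    using assms n by (intro exec_digits) (auto simp: enc_nat_def)
  have at: "drop (q + length (bin n)) x = VEnd # ys"
    using drop_append[of q x "map VBit (bin n)" "VEnd # ys"] q by (simp add: enc_nat_def)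
  let ?out = "out @ events_str (num_events s c 0 (bin n))" and ?p = "Suc (Suc (q + length (bin n)))"
  have 2: "exec x (length x) (clear RK) (?p, regs c (0 + length (bin n)) 0 r, ?out) (?p, regs c 0 0 r, ?out)"
    by (rule exec_eq[OF exec_clear]) simp
  have 3: "exec x (length x) (Up RC) (?p, regs c 0 0 r, ?out) (?p, regs (Suc c) 0 0 r, ?out)"
    using c by (intro exec_eq[OF exec.Up]) auto
  have 4: "exec x (length x) (Down RR) (?p, regs (Suc c) 0 0 r, ?out) (?p, regs (Suc c) 0 0 (r - 1), ?out)"
    by (rule exec_eq[OF exec.Down]) simp
  show ?thesis
    unfolding num_prog_def
    by (rule exec_eq, rule exec.Seq[OF 1 exec.Seq[OF at_symbol(3)[OF at] exec.Seq[OF 2 exec.Seq[OF 3 4]]]])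
      (simp add: enc_nat_def)
qed

definition int_prog :: "(vsym, reg, fsym) com" where
  "int_prog = Cond (Cell {InSym VMinus}) (Go MoveR ;; num_prog False) (num_prog True)"

lemma exec_int:
  assumes q: "drop q x = enc_int z @ ys" and c: "c < length x"
  shows "exec x (length x) int_prog (Suc q, regs c 0 0 r, out)
    (Suc (q + length (enc_int z)), regs (Suc c) 0 0 (r - 1),
     out @ events_str (num_events (fst (signed z)) c 0 (bin (snd (signed z)))))"
proof (cases "z < 0")
  case True
  then have at: "drop q x = VMinus # enc_nat (nat \<bar>z\<bar>) @ ys"
    using q by (simp add: enc_int_def)
  have "exec x (length x) int_prog (Suc q, regs c 0 0 r, out)
    (Suc (Suc q + length (enc_nat (nat \<bar>z\<bar>))), regs (Suc c) 0 0 (r - 1),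
     out @ events_str (num_events False c 0 (bin (nat \<bar>z\<bar>))))"
    unfolding int_prog_def
    using c at_symbol[OF at] by (intro exec.CondT exec.Seq[OF at_symbol(3)[OF at]] exec_num) auto
  with True show ?thesis by (simp add: enc_int_def signed_def)
next
  case False
  then have q': "drop q x = enc_nat (nat \<bar>z\<bar>) @ ys" using q by (simp add: enc_int_def)
  \<comment> \<open>An unsigned number starts with a digit or, if it is 0, with
    \<open>VEnd\<close>.\<close>
  have "scan_input x (Suc q) \<noteq> InSym VMinus"
    using q' at_symbol(1)[of q x "hd (enc_nat (nat \<bar>z\<bar>))" "tl (enc_nat (nat \<bar>z\<bar>)) @ ys"]
    by (cases "bin (nat \<bar>z\<bar>)") (auto simp: enc_nat_def)
  then have "exec x (length x) int_prog (Suc q, regs c 0 0 r, out)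
    (Suc (q + length (enc_nat (nat \<bar>z\<bar>))), regs (Suc c) 0 0 (r - 1),
     out @ events_str (num_events True c 0 (bin (nat \<bar>z\<bar>))))"
    unfolding int_prog_def using c q' by (intro exec.CondF exec_num) auto
  with False show ?thesis by (simp add: enc_int_def signed_def)
qed

text \<open>The entry program counts \<open>RR\<close> down and \<open>RC\<close> up. Afterwards
  \<open>RC\<close> holds the dimension, and shifting it back readies both registers for the next
  vector.\<close>

definition vec_prog :: "(vsym, reg, fsym) com \<Rightarrow> (vsym, reg, fsym) com" where
  "vec_prog e = While (Pos RR) e ;; shift RC RR []"

text \<open>Stated for any entry program \<open>e\<close>, as it serves both the signed entries of
  transitions and the unsigned ones of configurations.\<close>

lemma exec_vec:
  fixes enc :: "'a \<Rightarrow> vsym list"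
  assumes e: "\<And>q z ys c r out. drop q x = enc z @ ys \<Longrightarrow> c < length x \<Longrightarrow>
      exec x (length x) e (Suc q, regs c 0 0 r, out)
       (Suc (q + length (enc z)), regs (Suc c) 0 0 (r - 1),
        out @ events_str (num_events (fst (f z)) c 0 (bin (snd (f z)))))"
    and q: "drop q x = concat (map enc v) @ ys" and r: "length v \<le> length x"
  shows "exec x (length x) (vec_prog e) (Suc q, regs 0 0 0 (length v), out)
    (Suc (q + length (concat (map enc v))), regs 0 0 0 (length v), out @ events_str (vec_events 0 (map f v)))"
proof -
  have "exec x (length x) (While (Pos RR) e) (Suc q, regs c 0 0 (length v), out)
    (Suc (q + length (concat (map enc v))), regs (c + length v) 0 0 0, out @ events_str (vec_events c (map f v)))"
    if "c + length v \<le> length x" for c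
    using that q
  proof (induction v arbitrary: c q out)
    case Nil
    then show ?case by (auto intro!: exec_eq[OF exec.WhileF])
  next
    case (Cons z v)
    have 1: "exec x (length x) e (Suc q, regs c 0 0 (Suc (length v)), out)
       (Suc (q + length (enc z)), regs (Suc c) 0 0 (Suc (length v) - 1),
        out @ events_str (num_events (fst (f z)) c 0 (bin (snd (f z)))))" (is "exec _ _ _ _ (_, _, ?out)")
      using Cons.prems by (intro e) auto
    have 2: "exec x (length x) (While (Pos RR) e) (Suc (q + length (enc z)), regs (Suc c) 0 0 (length v), ?out)
       (Suc (q + length (enc z) + length (concat (map enc v))), regs (Suc c + length v) 0 0 0,
         ?out @ events_str (vec_events (Suc c) (map f v)))"
      using Cons.prems drop_append[of q x "enc z"] by (intro Cons.IH) auto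
    show ?case using exec.WhileT[OF _ 1, of "Pos RR"] 2
      by (cases "f z") (auto simp: add.assoc)
  qed
  from this[of 0] r have 1: "exec x (length x) (While (Pos RR) e) (Suc q, regs 0 0 0 (length v), out)
    (Suc (q + length (concat (map enc v))), regs (length v) 0 0 0, out @ events_str (vec_events 0 (map f v)))"
    by simp
  show ?thesis unfolding vec_prog_def
    by (rule exec_eq, rule exec.Seq[OF 1], rule exec_shift) (use r in simp_all)
qed

definition state_prog :: "bool \<Rightarrow> (vsym, reg, fsym) com" where
  "state_prog s = emits (pre_str s) ;;
     While (Cell digit_cells) (Cond (Cell {InSym (VBit True)}) (emits (letter_str (Bit True)))
       (emits (letter_str (Bit False))) ;; Go MoveR) ;;
     Go MoveR ;; emits (letter_str Stop @ post_str s)"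

lemma exec_state:
  assumes q: "drop q x = enc_nat n @ ys"
  shows "exec x B (state_prog s) (Suc q, cs, out)
    (Suc (q + length (enc_nat n)), cs, out @ event_str (s, St n))"
proof -
  let ?W = "While (Cell digit_cells) (Cond (Cell {InSym (VBit True)}) (emits (letter_str (Bit True)))
       (emits (letter_str (Bit False))) ;; Go MoveR)"
  have 1: "exec x B ?W (Suc q, cs, out)
     (Suc (q + length bs), cs, out @ concat (map (\<lambda>b. letter_str (Bit b)) bs))"
    if "drop q x = map VBit bs @ VEnd # ys" for bs q out
    using that
  proof (induction bs arbitrary: q out)
    case Nil
    then show ?case by (auto simp: at_symbol intro!: exec_eq[OF exec.WhileF])
  next
    case (Cons b bs)
    note at = at_symbol[of q x "VBit b" "map VBit bs @ VEnd # ys"]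
    have 1: "exec x B (Cond (Cell {InSym (VBit True)}) (emits (letter_str (Bit True)))
       (emits (letter_str (Bit False)))) (Suc q, cs, out) (Suc q, cs, out @ letter_str (Bit b))"
    proof (cases b)
      case True
      with Cons.prems show ?thesis by (intro exec.CondT) (auto simp: at intro: exec_emits)
    next
      case False
      with Cons.prems show ?thesis by (intro exec.CondF) (auto simp: at intro: exec_emits)
    qed
    show ?case
      using Cons.prems exec.WhileT[OF _ exec.Seq[OF 1 at(3)], of "Cell digit_cells"]
        Cons.IH[of "Suc q" "out @ letter_str (Bit b)"]
      by (cases b) (auto simp: at)
  qed
  have at: "drop (q + length (bin n)) x = VEnd # ys"
    using drop_append[of q x "map VBit (bin n)" "VEnd # ys"] q by (simp add: enc_nat_def)
  have q': "drop q x = map VBit (bin n) @ VEnd # ys" using q by (simp add: enc_nat_def)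
  show ?thesis
    unfolding state_prog_def
    by (rule exec_eq, rule exec.Seq[OF exec_emits exec.Seq[OF 1[OF q'] exec.Seq[OF at_symbol(3)[OF at] exec_emits]]])
      (simp add: event_str_def enc_nat_def comp_def)
qed

definition enc_trans :: "nat \<times> int list \<times> nat \<Rightarrow> vsym list" where
  "enc_trans = (\<lambda>(q, u, q'). VMark # enc_nat q @ concat (map enc_int u) @ enc_nat q')"

definition trans_prog :: "(vsym, reg, fsym) com" where
  "trans_prog = While (Cell {InSym VMark}) (Go MoveR ;; emits alt_str ;; state_prog False ;;
     vec_prog int_prog ;; state_prog True ;; emits (enc_plrv (lit Blk)))"

lemma at_end: "drop q x = [] \<Longrightarrow> scan_input x (Suc q) = RightEnd"
  by (simp add: scan_input_def)

lemma exec_trans: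
  assumes "drop q x = concat (map enc_trans ts)"
    and "\<forall>(p, u, p')\<in>set ts. length u = d" "d \<le> length x"
  shows "exec x (length x) trans_prog (Suc q, regs 0 0 0 d, out)
    (Suc (q + length (concat (map enc_trans ts))), regs 0 0 0 d,
     out @ concat (map (\<lambda>t. choice_str (trans_events t)) ts))"
  using assms
proof (induction ts arbitrary: q out)
  case Nil
  then show ?case by (auto simp: trans_prog_def at_end intro!: exec_eq[OF exec.WhileF])
next
  case (Cons t ts)
  obtain a u b where t: "t = (a, u, b)" by (cases t)
  let ?rest = "concat (map enc_trans ts)"
  have at: "drop q x = VMark # enc_nat a @ concat (map enc_int u) @ enc_nat b @ ?rest"
    using Cons.prems by (simp add: t enc_trans_def)
  from at_symbol(2)[OF at] have a: "drop (Suc q) x = enc_nat a @ concat (map enc_int u) @ enc_nat b @ ?rest" .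
  from drop_append[OF this] have u: "drop (Suc q + length (enc_nat a)) x = concat (map enc_int u) @ enc_nat b @ ?rest" .
  from drop_append[OF this] have b: "drop (Suc q + length (enc_nat a) + length (concat (map enc_int u))) x = enc_nat b @ ?rest" .
  from drop_append[OF this] have r: "drop (Suc q + length (enc_nat a) + length (concat (map enc_int u)) + length (enc_nat b)) x = ?rest" .
  have d: "length u = d" "length u \<le> length x" using Cons.prems by (auto simp: t)
  note V = exec_vec[OF exec_int u d(2), unfolded d(1)]
  note 1 = exec.Seq[OF at_symbol(3)[OF at] exec.Seq[OF exec_emits exec.Seq[OF exec_state[OF a]
        exec.Seq[OF V exec.Seq[OF exec_state[OF b] exec_emits]]]]]
  note IH = Cons.IH[OF r]
  show ?case
    unfolding trans_prog_def
    by (rule exec_eq, rule exec.WhileT[OF _ 1 IH[unfolded trans_prog_def]])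
      (use Cons.prems in \<open>auto simp: at_symbol[OF at] t enc_trans_def trans_events_def choice_str_def\<close>)
qed

section \<open>Enumeration of splits and merges\<close>

definition rewind :: "('i, 'r, 'o) com" where
  "rewind = While (Cell (- {LeftEnd})) (Go MoveL) ;; Go MoveR"

lemma exec_rewind: "exec x B rewind (p, cs, out) (Suc 0, cs, out)"
proof -
  have "exec x B (While (Cell (- {LeftEnd})) (Go MoveL)) (p, cs, out) (0, cs, out)"
  proof (induction p rule: less_induct)
    case (less p)
    show ?case
    proof (cases p)
      case 0
      then show ?thesis by (auto simp: scan_input_def intro!: exec_eq[OF exec.WhileF])
    next
      case (Suc n)
      then show ?thesis
        by (intro exec.WhileT[OF _ exec.Go less.IH]) (auto simp: scan_input_def)
    qed
  qed
  from exec.Seq[OF this exec.Go[of x B MoveR]] show ?thesis by (simp add: rewind_def)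
qed

definition measure_input :: "'r \<Rightarrow> ('i, 'r, 'o) com" where
  "measure_input a = rewind ;; While (Cell (- {RightEnd})) (Up a ;; Go MoveR)"

lemma exec_measure_input:
  assumes "cs a = 0"
  shows "exec x (length x) (measure_input a) (p, cs, out) (Suc (length x), cs(a := length x), out)"
proof -
  \<comment> \<open>Induction on the number \<open>n\<close> of cells still to be passed; the
    register holds the number of those already passed.\<close>
  have "exec x (length x) (While (Cell (- {RightEnd})) (Up a ;; Go MoveR)) (Suc (length x - n), cs(a := length x - n), out)
      (Suc (length x), cs(a := length x), out)" if "n \<le> length x" for n
    using that
  proof (induction n)
    case 0
    then show ?case by (auto simp: scan_input_def intro!: exec_eq[OF exec.WhileF])
  next
    case (Suc n)
    have "exec x (length x) (Up a ;; Go MoveR) (Suc (length x - Suc n), cs(a := length x - Suc n), out)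
        (Suc (length x - n), cs(a := length x - n), out)"
      using Suc.prems by (intro exec_eq[OF exec.Seq[OF exec.Up exec.Go]]) (auto simp: Suc_diff_Suc)
    from exec.WhileT[OF _ this Suc.IH] Suc.prems show ?case
      by (simp add: scan_input_def del: fun_upd_apply)
  qed
  from this[of "length x"] assms
  have "exec x (length x) (While (Cell (- {RightEnd})) (Up a ;; Go MoveR)) (Suc 0, cs, out)
      (Suc (length x), cs(a := length x), out)"
    by (simp add: fun_upd_idem)
  from exec.Seq[OF exec_rewind this] show ?thesis by (simp add: measure_input_def)
qed

definition carry_prog :: "('i, reg, fsym) com" where
  "carry_prog =
     emits alt_str ;; Up RK ;; event_prog False ;; Down RK ;; event_prog True ;; event_prog True ;;
     emits (enc_plrv (lit Blk)) ;;
     emits alt_str ;; event_prog False ;; event_prog False ;; Up RK ;; event_prog True ;; Down RK ;;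
     emits (enc_plrv (lit Blk))"

lemma exec_carry:
  assumes "c \<le> B" "k < B"
  shows "exec x B carry_prog (p, regs c k 0 r, out) (p, regs c k 0 r,
    out @ choice_str (split_events c k) @ choice_str (merge_events c k))"
proof -
  have up: "exec x B (Up RK) (p, regs c k 0 r, out) (p, regs c (Suc k) 0 r, out)" for out
    using assms by (intro exec_eq[OF exec.Up]) auto
  have down: "exec x B (Down RK) (p, regs c (Suc k) 0 r, out) (p, regs c k 0 r, out)" for out
    by (intro exec_eq[OF exec.Down]) auto
  show ?thesis
    unfolding carry_prog_def
    by (rule exec_eq, (rule exec.Seq up down exec_emits | rule exec_event, use assms in simp, use assms in simp)+)
      (use assms in \<open>auto simp: choice_str_def split_events_def merge_events_def\<close>)
qed

text \<open>Decrementing before the body makes each loop visit the values from \<open>N - 1\<close>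
  down to 0. The inner bound is measured afresh every time, which saves a register for it.\<close>

definition carries_prog :: "('i, reg, fsym) com" where
  "carries_prog = measure_input RC ;;
     While (Pos RC) (Down RC ;; measure_input RK ;; While (Pos RK) (Down RK ;; carry_prog))"

lemma concat_concat_map: "concat (concat (map f xs)) = concat (map (\<lambda>x. concat (f x)) xs)"
  by (induction xs) auto

lemma exec_carries:
  "exec x (length x) carries_prog (p, regs 0 0 0 r, out) (Suc (length x), regs 0 0 0 r,
     out @ concat (map choice_str (carry_events (length x))))"
proof -
  let ?inner = "\<lambda>c n. concat (map (\<lambda>k. choice_str (split_events c k) @ choice_str (merge_events c k)) (rev [0..<n]))"
  let ?p = "Suc (length x)"
  have inner: "exec x (length x) (While (Pos RK) (Down RK ;; carry_prog)) (?p, regs c n 0 r, out)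
    (?p, regs c 0 0 r, out @ ?inner c n)" if "c \<le> length x" "n \<le> length x" for c n out
    using that(2)
  proof (induction n arbitrary: out)
    case 0
    then show ?case by (auto intro!: exec_eq[OF exec.WhileF])
  next
    case (Suc n)
    have "exec x (length x) (Down RK ;; carry_prog) (?p, regs c (Suc n) 0 r, out)
        (?p, regs c n 0 r, out @ choice_str (split_events c n) @ choice_str (merge_events c n))"
      using Suc.prems that(1) exec.Down[of x "length x" RK ?p "regs c (Suc n) 0 r" out]
      by (auto intro!: exec.Seq exec_carry)
    from exec.WhileT[OF _ this Suc.IH] Suc.prems show ?case by simp
  qed
  have outer: "exec x (length x) (While (Pos RC) (Down RC ;; measure_input RK ;; While (Pos RK) (Down RK ;; carry_prog)))
    (?p, regs m 0 0 r, out)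
    (?p, regs 0 0 0 r, out @ concat (map (\<lambda>c. ?inner c (length x)) (rev [0..<m])))" if "m \<le> length x" for m
    using that
  proof (induction m arbitrary: out)
    case 0
    then show ?case by (auto intro!: exec_eq[OF exec.WhileF])
  next
    case (Suc m)
    have 1: "exec x (length x) (Down RC) (?p, regs (Suc m) 0 0 r, out) (?p, regs m 0 0 r, out)"
      by (intro exec_eq[OF exec.Down]) auto
    have 2: "exec x (length x) (measure_input RK) (?p, regs m 0 0 r, out) (?p, regs m (length x) 0 r, out)"
      by (intro exec_eq[OF exec_measure_input]) auto
    have 3: "exec x (length x) (While (Pos RK) (Down RK ;; carry_prog)) (?p, regs m (length x) 0 r, out)
      (?p, regs m 0 0 r, out @ ?inner m (length x))"
      using Suc.prems by (intro inner) auto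
    from exec.WhileT[OF _ exec.Seq[OF 1 exec.Seq[OF 2 3]] Suc.IH] Suc.prems
    show ?case by simp
  qed
  have 1: "exec x (length x) (measure_input RC) (p, regs 0 0 0 r, out) (?p, regs (length x) 0 0 r, out)"
    by (intro exec_eq[OF exec_measure_input]) auto
  from exec.Seq[OF 1 outer] show ?thesis
    by (simp add: carries_prog_def carry_events_def map_concat comp_def concat_concat_map)
qed

definition marks_prog :: "(vsym, reg, fsym) com \<Rightarrow> (vsym, reg, fsym) com" where
  "marks_prog e = While (Cell {InSym VMark}) (e ;; Go MoveR) ;; Go MoveR"

definition main_prog :: "(vsym, reg, fsym) com" where
  "main_prog = Go MoveR ;; marks_prog Skip ;; marks_prog (Up RR) ;;
     emits head_str ;; state_prog True ;; vec_prog (num_prog True) ;;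
     emits (enc_plrv (lit Blk) @ mid_str @ alt_str) ;; state_prog False ;; vec_prog (num_prog False) ;;
     emits (enc_plrv end_pos) ;; trans_prog ;; carries_prog ;; emits (enc_plrv tt)"

text \<open>\<open>f j\<close> is the register content after \<open>j\<close> marks: constant when
  the number of states is skipped, counting in \<open>RR\<close> when the dimension is read.\<close>

lemma exec_marks:
  assumes e: "\<And>j p. j < n \<Longrightarrow> exec x B e (p, f j, out) (p, f (Suc j), out)"
    and q: "drop q x = replicate n VMark @ VEnd # ys"
  shows "exec x B (marks_prog e) (Suc q, f 0, out) (Suc (Suc (q + n)), f n, out)"
proof -
  have "exec x B (While (Cell {InSym VMark}) (e ;; Go MoveR)) (Suc q, f j, out) (Suc (q + m), f (j + m), out)"
    if "drop q x = replicate m VMark @ VEnd # ys" "j + m \<le> n" for q m j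
    using that
  proof (induction m arbitrary: q j)
    case 0
    then show ?case by (auto simp: at_symbol intro!: exec_eq[OF exec.WhileF])
  next
    case (Suc m)
    then have at: "drop q x = VMark # replicate m VMark @ VEnd # ys" by simp
    from Suc.prems e[of j] have "exec x B e (Suc q, f j, out) (Suc q, f (Suc j), out)" by simp
    from exec.WhileT[OF _ exec.Seq[OF this at_symbol(3)[OF at]] Suc.IH[OF at_symbol(2)[OF at]]]
    show ?case using Suc.prems by (simp add: at_symbol[OF at])
  qed
  from this[OF q, of 0] have 1: "exec x B (While (Cell {InSym VMark}) (e ;; Go MoveR)) (Suc q, f 0, out) (Suc (q + n), f n, out)"
    by simp
  have "drop (q + n) x = VEnd # ys"
    using drop_append[OF q] by simp
  from exec.Seq[OF 1 at_symbol(3)[OF this]] show ?thesis by (simp add: marks_prog_def)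
qed

text \<open>Source, target and transitions occur in the formula in the order of the encoding, so one
  pass from left to right writes them; the carries afterwards look at the input only for its
  length.\<close>

theorem exec_main:
  assumes "I \<in> vass_instances"
  shows "\<exists>p cs. exec (enc_vass I) (length (enc_vass I)) main_prog (0, \<lambda>_. 0, [])
    (p, cs, enc_plrv (run_formula I))"
proof -
  let ?x = "enc_vass I" and ?n = "inst_states I" and ?d = "inst_dim I"
  obtain q v where s: "inst_source I = (q, v)" by fastforce
  obtain q' v' where t: "inst_target I = (q', v')" by fastforce
  let ?ts = "concat (map enc_trans (inst_trans I))"
  let ?v = "concat (map enc_nat v)" and ?v' = "concat (map enc_nat v')"
  from assms have d: "length v = ?d" "length v' = ?d" and ts: "\<forall>(p, u, p')\<in>set (inst_trans I). length u = ?d"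
    by (auto simp: vass_instances_def s t)
  have 1: "drop 0 ?x = replicate ?n VMark @ VEnd # replicate ?d VMark @ VEnd #
      enc_nat q @ ?v @ enc_nat q' @ ?v' @ ?ts"
    by (simp add: enc_vass_def s t enc_trans_def)
  let ?p1 = "Suc ?n"
  from drop_append[of 0 ?x "replicate ?n VMark @ [VEnd]"] 1
  have 2: "drop ?p1 ?x = replicate ?d VMark @ VEnd # enc_nat q @ ?v @ enc_nat q' @ ?v' @ ?ts" by simp
  let ?p2 = "Suc (?p1 + ?d)"
  from drop_append[of ?p1 ?x "replicate ?d VMark @ [VEnd]"] 2
  have 3: "drop ?p2 ?x = enc_nat q @ ?v @ enc_nat q' @ ?v' @ ?ts" by simp
  from drop_append[OF 3] have 4: "drop (?p2 + length (enc_nat q)) ?x = ?v @ enc_nat q' @ ?v' @ ?ts" .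
  from drop_append[OF 4] have 5: "drop (?p2 + length (enc_nat q) + length ?v) ?x = enc_nat q' @ ?v' @ ?ts" .
  from drop_append[OF 5] have 6: "drop (?p2 + length (enc_nat q) + length ?v + length (enc_nat q')) ?x = ?v' @ ?ts" .
  from drop_append[OF 6] have 7: "drop (?p2 + length (enc_nat q) + length ?v + length (enc_nat q') + length ?v') ?x = ?ts" .
  have "length ?x = length (drop 0 ?x)" by simp
  then have dx: "?d \<le> length ?x" unfolding 1 by simp
  note dx' = d(1)[THEN eq_refl, THEN order_trans, OF dx] d(2)[THEN eq_refl, THEN order_trans, OF dx]
  have zero: "(\<lambda>_. 0) = regs 0 0 0 (0::nat)" by (auto simp: fun_eq_iff regs_def split: reg.split)
  have start: "exec ?x (length ?x) (Go MoveR) (0, \<lambda>_. 0, []) (Suc 0, regs 0 0 0 0, [])"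
    unfolding zero by (intro exec_eq[OF exec.Go]) simp
  have m1: "exec ?x (length ?x) (marks_prog Skip) (Suc 0, regs 0 0 0 0, []) (Suc ?p1, regs 0 0 0 0, [])"
    using exec_marks[OF exec.Skip 1, of "\<lambda>_. regs 0 0 0 0"] by simp
  have m2: "exec ?x (length ?x) (marks_prog (Up RR)) (Suc ?p1, regs 0 0 0 0, []) (Suc ?p2, regs 0 0 0 ?d, [])"
    using dx by (intro exec_marks[where f = "regs 0 0 0", OF _ 2]) (auto intro!: exec_eq[OF exec.Up])
  have num: "exec ?x (length ?x) (num_prog s) (Suc q, regs c 0 0 r, out)
      (Suc (q + length (enc_nat z)), regs (Suc c) 0 0 (r - 1),
       out @ events_str (num_events (fst (Pair s z)) c 0 (bin (snd (Pair s z)))))"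
    if "drop q ?x = enc_nat z @ ys" "c < length ?x" for q z ys c r s out
    using exec_num[OF that] by simp
  note V = exec_vec[OF num 4 dx'(1), unfolded d(1)] exec_vec[OF num 6 dx'(2), unfolded d(2)]
  have "exec ?x (length ?x) main_prog (0, \<lambda>_. 0, [])
    (Suc (length ?x), regs 0 0 0 ?d, enc_plrv (run_formula I))"
    unfolding main_prog_def
    by (rule exec_eq, rule exec.Seq[OF start exec.Seq[OF m1 exec.Seq[OF m2 exec.Seq[OF exec_emits
      exec.Seq[OF exec_state[OF 3] exec.Seq[OF V(1) exec.Seq[OF exec_emits
      exec.Seq[OF exec_state[OF 5] exec.Seq[OF V(2) exec.Seq[OF exec_emits
      exec.Seq[OF exec_trans[OF 7 ts dx] exec.Seq[OF exec_carries exec_emits]]]]]]]]]]]])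
      (assumption+, simp only: enc_run_formula conf_events_def s t events_str_simps append_assoc append_Nil prod.case)
  then show ?thesis by blast
qed

section \<open>From models to runs\<close>

definition label :: "model \<Rightarrow> nat \<Rightarrow> bool \<times> bool \<times> bool" where
  "label \<sigma> i = ((\<sigma> ! i) 0 = (\<sigma> ! i) 1, (\<sigma> ! i) 0 = (\<sigma> ! i) 2, (\<sigma> ! i) 0 = (\<sigma> ! i) 3)"

lemma holds_tt [simp]: "holds \<sigma> i tt \<longleftrightarrow> i < length \<sigma>"
  by (simp add: tt_def)

lemma holds_lit [simp]: "i < length \<sigma> \<Longrightarrow> holds \<sigma> i (lit a) \<longleftrightarrow> label \<sigma> i = flags a"
  by (cases a) (auto simp: lit_def flag_def label_def)

lemma holds_spell:
  assumes "i < length \<sigma>"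
  shows "holds \<sigma> i (spell as \<psi>) \<longleftrightarrow> i + length as < length \<sigma> \<and>
    (\<forall>j<length as. label \<sigma> (i + j) = flags (as ! j)) \<and> holds \<sigma> (i + length as) \<psi>"
  using assms
proof (induction as arbitrary: i)
  case (Cons a as)
  show ?case
  proof (cases "Suc i < length \<sigma>")
    case True
    with Cons show ?thesis by (auto simp: All_less_Suc2)
  qed (use Cons.prems in auto)
qed simp

lemma holds_never: "holds \<sigma> 0 (never \<phi>) \<longleftrightarrow> (\<forall>j<length \<sigma>. \<not> holds \<sigma> j \<phi>)"
  by (auto simp: never_def)

lemma holds_none_next:
  "i < length \<sigma> \<Longrightarrow>
     holds \<sigma> i (none_next \<phi>s) \<longleftrightarrow> (\<forall>\<phi>\<in>set \<phi>s. \<not> (Suc i < length \<sigma> \<and> holds \<sigma> (Suc i) \<phi>))"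
  by (induction \<phi>s) auto

fun bits_value :: "bool list \<Rightarrow> nat" where
  "bits_value [] = 0"
| "bits_value (b # bs) = of_bool b + 2 * bits_value bs"

lemma bits_value_bin [simp]: "bits_value (bin n) = n"
proof (induction n rule: bin.induct)
  case (1 n)
  then show ?case by (subst bin.simps) (auto simp: odd_iff_mod_2_eq_one elim: oddE)
qed

lemma bin_inject: "bin m = bin n \<Longrightarrow> m = n"
  by (metis bits_value_bin)

lemma word_Stop: "\<exists>u. word w = u @ [Stop] \<and> Stop \<notin> set u"
proof (cases w)
  case (St q)
  then show ?thesis by (intro exI[of _ "map Bit (bin q)"]) auto
next
  case (Ct c k)
  then show ?thesis by (intro exI[of _ "replicate c (Bit False) @ [Sep] @ replicate k (Bit False)"]) auto
qed

lemma takeWhile_Bits: "takeWhile (\<lambda>a. a \<noteq> Sep) (replicate c (Bit False) @ Sep # as) = replicate c (Bit False)"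
  by (induction c) auto

lemma word_inject: "word v = word w \<Longrightarrow> v = w"
proof (cases v; cases w)
  fix q q' assume *: "v = St q" "w = St q'" "word v = word w"
  from * have "map Bit (bin q) = map Bit (bin q')" by simp
  then have "bin q = bin q'" by (simp add: inj_map_eq_map inj_def)
  with * show "v = w" by (auto dest: bin_inject)
next
  fix c k c' k' assume *: "v = Ct c k" "w = Ct c' k'" "word v = word w"
  then have "takeWhile (\<lambda>a. a \<noteq> Sep) (word v) = takeWhile (\<lambda>a. a \<noteq> Sep) (word w)"
    by (metis)
  with * have "replicate c (Bit False) = replicate c' (Bit False)" by (simp add: takeWhile_Bits)
  then have "c = c'" by simp
  with * show "v = w" by simp
next
  fix q c k assume *: "v = St q" "w = Ct c k" "word v = word w"
  have "Sep \<in> set (word w)" using *(2) by simp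
  then have "Sep \<in> set (word (St q))" unfolding *(3)[symmetric] *(1) .
  then show "v = w" by auto
next
  fix q c k assume *: "v = Ct c k" "w = St q" "word v = word w"
  have "Sep \<in> set (word v)" using *(1) by simp
  then have "Sep \<in> set (word (St q))" unfolding *(3) *(2) .
  then show "v = w" by auto
qed

text \<open>\<open>Stop\<close> occurs in a word only as its last letter. If one word were shorter,
  its \<open>Stop\<close> would meet an inner letter of the other.\<close>

lemma word_prefix_free:
  assumes "\<forall>j. j < length (word v) \<and> j < length (word w) \<longrightarrow> word v ! j = word w ! j"
  shows "v = w"
proof -
  obtain u u' where u: "word v = u @ [Stop]" "Stop \<notin> set u" and u': "word w = u' @ [Stop]" "Stop \<notin> set u'"
    using word_Stop by metis
  have "\<not> length u < length u'" "\<not> length u' < length u"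
    using assms[rule_format, of "length u"] assms[rule_format, of "length u'"] u u'
    by (auto simp: nth_append in_set_conv_nth split: if_splits)
  with assms have "word v = word w"
    by (intro nth_equalityI) (auto simp: u u')
  then show ?thesis by (rule word_inject)
qed

section \<open>Increments, decrements and token balances\<close>

definition inc_at :: "model \<Rightarrow> name \<Rightarrow> nat \<Rightarrow> bool" where
  "inc_at \<sigma> w p \<longleftrightarrow> p < length \<sigma> \<and> holds \<sigma> p (produced w)"

definition dec_at :: "model \<Rightarrow> name \<Rightarrow> nat \<Rightarrow> bool" where
  "dec_at \<sigma> w q \<longleftrightarrow> q < length \<sigma> \<and> label \<sigma> q = flags Dec \<and>
     (\<exists>p<q. (\<sigma> ! q) 0 = (\<sigma> ! p) 0 \<and> inc_at \<sigma> w p)"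

lemma dec_at_iff: "q < length \<sigma> \<Longrightarrow> dec_at \<sigma> w q \<longleftrightarrow> holds \<sigma> q (And (lit Dec) (EqPast 0 (produced w) 0))"
  by (auto simp: dec_at_def inc_at_def)

lemma inc_at_label: "inc_at \<sigma> w p \<Longrightarrow> label \<sigma> p = flags Inc"
  by (auto simp: inc_at_def produced_def)

lemma inc_at_word:
  assumes "inc_at \<sigma> w p" "j < length (word w)"
  shows "label \<sigma> (p + Suc j) = flags (word w ! j)"
proof -
  have "p < length \<sigma>" "holds \<sigma> p (spell (Inc # word w) tt)"
    using assms(1) by (simp_all add: inc_at_def produced_def)
  then have "\<forall>j<length (Inc # word w). label \<sigma> (p + j) = flags ((Inc # word w) ! j)"
    by (simp add: holds_spell del: spell.simps)
  from this[rule_format, of "Suc j"] assms(2) show ?thesis by simp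
qed

lemma inc_at_less: "inc_at \<sigma> w p \<Longrightarrow> p < length \<sigma>"
  by (simp add: inc_at_def)

lemma dec_atD: "dec_at \<sigma> w q \<Longrightarrow> q < length \<sigma>" "dec_at \<sigma> w q \<Longrightarrow> label \<sigma> q = flags Dec"
  by (simp_all add: dec_at_def)

lemma inc_at_unique:
  assumes "inc_at \<sigma> v p" "inc_at \<sigma> w p"
  shows "v = w"
proof (rule word_prefix_free, intro allI impI)
  fix j assume "j < length (word v) \<and> j < length (word w)"
  with inc_at_word[OF assms(1)] inc_at_word[OF assms(2)] have "flags (word v ! j) = flags (word w ! j)"
    by metis
  then show "word v ! j = word w ! j" by simp
qed

text \<open>Only positions before \<open>i\<close> count, so this is the marking met by an event
  that starts at \<open>i\<close>. It is an integer difference because its sign follows only from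
  the data conditions.\<close>

definition tok :: "model \<Rightarrow> name \<Rightarrow> nat \<Rightarrow> int" where
  "tok \<sigma> w i = int (card {p. p < i \<and> inc_at \<sigma> w p}) - int (card {q. q < i \<and> dec_at \<sigma> w q})"

lemma card_less_Suc_Collect:
  "card {p. p < Suc i \<and> P p} = card {p. p < i \<and> P p} + of_bool (P i)"
proof -
  have "{p. p < Suc i \<and> P p} = (if P i then insert i {p. p < i \<and> P p} else {p. p < i \<and> P p})"
    by (auto simp: less_Suc_eq)
  then show ?thesis by simp
qed

lemma tok_0 [simp]: "tok \<sigma> w 0 = 0"
  by (simp add: tok_def)

lemma tok_Suc: "tok \<sigma> w (Suc i) = tok \<sigma> w i + of_bool (inc_at \<sigma> w i) - of_bool (dec_at \<sigma> w i)"
  by (simp add: tok_def card_less_Suc_Collect)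

lemma tok_Suc_other:
  assumes "label \<sigma> i \<noteq> flags Inc" "label \<sigma> i \<noteq> flags Dec"
  shows "tok \<sigma> w (Suc i) = tok \<sigma> w i"
  using assms by (auto simp: tok_Suc dec_at_def dest: inc_at_label simp del: flags.simps)

lemma tok_skip:
  assumes "\<forall>j<m. label \<sigma> (i + j) \<noteq> flags Inc \<and> label \<sigma> (i + j) \<noteq> flags Dec"
  shows "tok \<sigma> w (i + m) = tok \<sigma> w i"
  using assms by (induction m) (auto simp: tok_Suc_other)

definition effect :: "event list \<Rightarrow> name \<Rightarrow> int" where
  "effect es w = int (count_list es (True, w)) - int (count_list es (False, w))"

lemma word_letters: "Inc \<notin> set (word w)" "Dec \<notin> set (word w)"
  by (cases w; auto)+

locale tokens =
  fixes \<sigma> :: model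
  assumes inc_once: "holds \<sigma> 0 inc_once"
    and dec_once: "holds \<sigma> 0 dec_once"
    and inc_used: "holds \<sigma> 0 inc_used"
begin

lemma inc_eqI:
  assumes "p < length \<sigma>" "p' < length \<sigma>" "label \<sigma> p = flags Inc" "label \<sigma> p' = flags Inc"
    "(\<sigma> ! p) 0 = (\<sigma> ! p') 0"
  shows "p = p'"
  using inc_once assms unfolding inc_once_def holds_never
  by (simp del: flags.simps) (metis linorder_neqE_nat)

lemma dec_eqI:
  assumes "p < length \<sigma>" "p' < length \<sigma>" "label \<sigma> p = flags Dec" "label \<sigma> p' = flags Dec"
    "(\<sigma> ! p) 0 = (\<sigma> ! p') 0"
  shows "p = p'"
  using dec_once assms unfolding dec_once_def holds_never
  by (simp del: flags.simps) (metis linorder_neqE_nat)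

text \<open>Increments carry distinct data, so the datum of a decrement determines the increment,
  and prefix-freeness determines its name.\<close>

lemma dec_at_unique:
  assumes "dec_at \<sigma> v q" "dec_at \<sigma> w q"
  shows "v = w"
proof -
  obtain p p' where "inc_at \<sigma> v p" "inc_at \<sigma> w p'" "(\<sigma> ! p) 0 = (\<sigma> ! p') 0"
    using assms by (metis dec_at_def)
  moreover from this have "p = p'"
    by - (rule inc_eqI; simp add: inc_at_less inc_at_label del: flags.simps)
  ultimately show ?thesis by (simp add: inc_at_unique)
qed

text \<open>Send a decrement to the earlier increment with its datum. Distinct decrements carry
  distinct data, so the map is injective, and since it goes backwards it stays inside every
  prefix.\<close>

lemma tok_nonneg: "0 \<le> tok \<sigma> w i"
proof -
  define f where "f = (\<lambda>q. SOME p. p < q \<and> (\<sigma> ! q) 0 = (\<sigma> ! p) 0 \<and> inc_at \<sigma> w p)"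
  have f: "f q < q \<and> (\<sigma> ! q) 0 = (\<sigma> ! f q) 0 \<and> inc_at \<sigma> w (f q)" if "dec_at \<sigma> w q" for q
    unfolding f_def by (rule someI_ex) (use that in \<open>auto simp: dec_at_def\<close>)
  have "card {q. q < i \<and> dec_at \<sigma> w q} \<le> card {p. p < i \<and> inc_at \<sigma> w p}"
  proof (rule card_inj_on_le)
    show "inj_on f {q. q < i \<and> dec_at \<sigma> w q}"
    proof (rule inj_onI)
      fix q q' assume q: "q \<in> {q. q < i \<and> dec_at \<sigma> w q}" "q' \<in> {q. q < i \<and> dec_at \<sigma> w q}" "f q = f q'"
      with f[of q] f[of q'] show "q = q'"
        by - (rule dec_eqI; auto dest: dec_atD simp del: flags.simps)
    qed
    show "f ` {q. q < i \<and> dec_at \<sigma> w q} \<subseteq> {p. p < i \<and> inc_at \<sigma> w p}"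
      using f by fastforce
  qed simp
  then show ?thesis by (simp add: tok_def)
qed

text \<open>The reverse injection, from increments to the decrements that use them, goes forwards
  and hence compares the counts of the whole word only. With nonnegativity the final balance is
  0.\<close>

lemma tok_length: "tok \<sigma> w (length \<sigma>) = 0"
proof -
  define f where "f = (\<lambda>p. SOME q. q < length \<sigma> \<and> (\<sigma> ! p) 0 = (\<sigma> ! q) 0 \<and> dec_at \<sigma> w q)"
  have f: "f p < length \<sigma> \<and> (\<sigma> ! p) 0 = (\<sigma> ! f p) 0 \<and> dec_at \<sigma> w (f p)" if "inc_at \<sigma> w p" for p
    unfolding f_def
  proof (rule someI_ex)
    from that have p: "p < length \<sigma>" "label \<sigma> p = flags Inc"
      by (auto simp: inc_at_less inc_at_label simp del: flags.simps)
    with inc_used obtain q where "p < q" "q < length \<sigma>" "(\<sigma> ! p) 0 = (\<sigma> ! q) 0" "label \<sigma> q = flags Dec"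
      unfolding inc_used_def holds_never by (auto simp del: flags.simps)
    \<comment> \<open>The decrement \<open>q\<close> has the name \<open>w\<close> because
      \<open>p\<close> itself is its earlier increment.\<close>
    with that show "\<exists>q. q < length \<sigma> \<and> (\<sigma> ! p) 0 = (\<sigma> ! q) 0 \<and> dec_at \<sigma> w q"
      by (intro exI[of _ q]) (auto simp: dec_at_def simp del: flags.simps)
  qed
  have "card {p. p < length \<sigma> \<and> inc_at \<sigma> w p} \<le> card {q. q < length \<sigma> \<and> dec_at \<sigma> w q}"
  proof (rule card_inj_on_le)
    show "inj_on f {p. p < length \<sigma> \<and> inc_at \<sigma> w p}"
    proof (rule inj_onI)
      fix p p' assume p: "p \<in> {p. p < length \<sigma> \<and> inc_at \<sigma> w p}" "p' \<in> {p. p < length \<sigma> \<and> inc_at \<sigma> w p}" "f p = f p'"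
      with f[of p] f[of p'] show "p = p'"
        by - (rule inc_eqI; auto dest: inc_at_label simp del: flags.simps)
    qed
    show "f ` {p. p < length \<sigma> \<and> inc_at \<sigma> w p} \<subseteq> {q. q < length \<sigma> \<and> dec_at \<sigma> w q}"
      using f by auto
  qed simp
  with tok_nonneg[of w "length \<sigma>"] show ?thesis by (simp add: tok_def)
qed

lemma tok_dec:
  assumes "i < length \<sigma>" "holds \<sigma> i (chain \<tau> ((False, w) # es))"
  shows "tok \<sigma> v (Suc i) = tok \<sigma> v i - of_bool (v = w)"
proof -
  have "dec_at \<sigma> w i" using assms by (simp add: dec_at_iff)
  moreover from this have "\<not> inc_at \<sigma> v i"
    by (auto simp: dec_at_def dest!: inc_at_label)
  ultimately show ?thesis using dec_at_unique by (auto simp: tok_Suc)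
qed

text \<open>Along a chain the balance moves only at the \<open>Inc\<close> or \<open>Dec\<close>
  that opens an event, for the spelled names contain neither letter.\<close>

lemma chain_effect:
  assumes "i < length \<sigma>" "holds \<sigma> i (chain \<tau> es)"
  shows "\<exists>j\<ge>i. j < length \<sigma> \<and> holds \<sigma> j \<tau> \<and> (\<forall>w. tok \<sigma> w j = tok \<sigma> w i + effect es w)"
  using assms
proof (induction \<tau> es arbitrary: i rule: chain.induct)
  case (1 \<tau>)
  then show ?case by (auto simp: effect_def)
next
  case (2 \<tau> w es)
  let ?j = "Suc i + length (word w)"
  have sp: "?j < length \<sigma>" "\<forall>j<Suc (length (word w)). label \<sigma> (i + j) = flags ((Inc # word w) ! j)"
    "holds \<sigma> ?j (chain \<tau> es)"
    using 2(2,3) by (auto simp: holds_spell simp del: spell.simps)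
  \<comment> \<open>The chain continues after the spelled word, which provides the further position
    that \<open>produced\<close> asks for.\<close>
  have inc: "inc_at \<sigma> w i"
    using 2(2) sp(1,2) by (simp add: inc_at_def produced_def holds_spell del: spell.simps)
  then have "\<not> dec_at \<sigma> v i" for v
    by (auto simp: dec_at_def dest!: inc_at_label)
  with inc have *: "tok \<sigma> v (Suc i) = tok \<sigma> v i + of_bool (v = w)" for v
    using inc_at_unique by (auto simp: tok_Suc)
  have "tok \<sigma> v (Suc i + length (word w)) = tok \<sigma> v (Suc i)" for v
  proof (rule tok_skip, intro allI impI)
    fix j assume "j < length (word w)"
    with sp(2)[rule_format, of "Suc j"] word_letters[of w]
    show "label \<sigma> (Suc i + j) \<noteq> flags Inc \<and> label \<sigma> (Suc i + j) \<noteq> flags Dec"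
      by (auto simp: in_set_conv_nth simp del: flags.simps)
  qed
  with * have "tok \<sigma> v ?j = tok \<sigma> v i + of_bool (v = w)" for v by simp
  with 2(1)[OF sp(1,3)] obtain j where "j \<ge> ?j" "j < length \<sigma>" "holds \<sigma> j \<tau>"
    "\<forall>v. tok \<sigma> v j = tok \<sigma> v i + of_bool (v = w) + effect es v" by auto
  then show ?case by (intro exI[of _ j]) (auto simp: effect_def)
next
  case (3 \<tau> w es)
  from 3(3) have "Suc i < length \<sigma>" "holds \<sigma> (Suc i) (chain \<tau> es)" by auto
  from 3(1)[OF this] obtain j where j: "j \<ge> Suc i" "j < length \<sigma>" "holds \<sigma> j \<tau>"
    "\<forall>v. tok \<sigma> v j = tok \<sigma> v (Suc i) + effect es v" by blast
  with tok_dec[OF 3(2,3)] show ?case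
    by (intro exI[of _ j]) (auto simp: effect_def)
qed

end

section \<open>Weighted sums of event lists\<close>

definition weight :: "nat \<Rightarrow> event list \<Rightarrow> bool \<Rightarrow> nat \<Rightarrow> nat" where
  "weight N es s c = (\<Sum>k\<le>N. 2 ^ k * count_list es (s, Ct c k))"

lemma weight_simps [simp]:
  "weight N [] s c = 0"
  "weight N (es @ fs) s c = weight N es s c + weight N fs s c"
  "weight N ((s', St q) # es) s c = weight N es s c"
  by (simp_all add: weight_def distrib_left sum.distrib)

lemma weight_Ct [simp]:
  assumes "k \<le> N"
  shows "weight N ((s', Ct c' k) # es) s c = of_bool (s' = s \<and> c' = c) * 2 ^ k + weight N es s c"
proof -
  have "weight N ((s', Ct c' k) # es) s c =
      (\<Sum>j\<le>N. (if j = k then of_bool (s' = s \<and> c' = c) * 2 ^ k else 0) + 2 ^ j * count_list es (s, Ct c j))"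
    unfolding weight_def by (intro sum.cong) auto
  with assms show ?thesis by (simp add: sum.distrib weight_def)
qed

lemma weight_num_events:
  "k + length bs \<le> Suc N \<Longrightarrow>
     weight N (num_events s' c' k bs) s c = of_bool (s' = s \<and> c' = c) * 2 ^ k * bits_value bs"
  by (induction bs arbitrary: k) (auto simp: algebra_simps)

lemma weight_vec_events:
  assumes "\<forall>(s, n)\<in>set ns. length (bin n) \<le> N"
  shows "weight N (vec_events c' ns) s c =
    (if c' \<le> c \<and> c < c' + length ns \<and> fst (ns ! (c - c')) = s then snd (ns ! (c - c')) else 0)"
  using assms
proof (induction c' ns rule: vec_events.induct)
  case (2 c' s' n ns)
  show ?case
  proof (cases "c = c'")
    case True
    with 2 show ?thesis by (auto simp: weight_num_events)
  next
    case False
    with 2 show ?thesis by (auto simp: weight_num_events nth_Cons' Suc_le_eq)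
  qed
qed simp

lemma count_num_events_St [simp]: "count_list (num_events s c k bs) (s', St q) = 0"
  by (induction bs arbitrary: k) auto

lemma count_vec_events_St [simp]: "count_list (vec_events c ns) (s', St q) = 0"
  by (induction c ns rule: vec_events.induct) auto

lemma count_conf_events_St [simp]: "count_list (conf_events s (q, v)) (s', St q') = of_bool (s = s' \<and> q = q')"
  by (simp add: conf_events_def)

lemma count_trans_events_St [simp]:
  "count_list (trans_events (q, u, q')) (s, St p) = (if s then of_bool (p = q') else of_bool (p = q))"
  by (auto simp: trans_events_def)

lemma weight_conf_events:
  assumes "\<forall>n\<in>set v. length (bin n) \<le> N"
  shows "weight N (conf_events s (q, v)) s' c = (if s = s' then vec_of v c else 0)"
  using assms by (auto simp: conf_events_def weight_vec_events vec_of_def)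

text \<open>Each entry has a single sign, so its positive part is produced and its negative part
  consumed, and at most one of them is nonzero.\<close>

lemma weight_trans_events:
  assumes "\<forall>z\<in>set u. length (bin (nat \<bar>z\<bar>)) \<le> N"
  shows "weight N (trans_events (q, u, q')) True c = nat (vec_of u c)"
    "weight N (trans_events (q, u, q')) False c = nat (- vec_of u c)"
  using assms by (auto simp: trans_events_def weight_vec_events vec_of_def signed_def)

text \<open>\<open>2 ^ Suc k\<close> is twice \<open>2 ^ k\<close>, and by \<open>k < N\<close> both
  levels lie in the range of the sum.\<close>

lemma weight_carry_events:
  assumes "es \<in> set (carry_events N)"
  shows "weight N es True c = weight N es False c"
  using assms by (auto simp: set_carry_events split_events_def merge_events_def)

lemma count_carry_events_St: "es \<in> set (carry_events N) \<Longrightarrow> count_list es (s, St q) = 0"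
  by (auto simp: set_carry_events split_events_def merge_events_def)

lemma length_enc_nat [simp]: "length (enc_nat n) = Suc (length (bin n))"
  by (simp add: enc_nat_def)

lemma length_concat_ge: "x \<in> set xs \<Longrightarrow> length (f x) \<le> length (concat (map f xs))"
  by (induction xs) auto

text \<open>The reason why the input length may bound levels and counters: every digit and every
  counter occupies a symbol of the encoding.\<close>

lemma bits_bounded:
  assumes "I \<in> vass_instances"
  shows "n \<in> set (snd (inst_source I)) \<Longrightarrow> length (bin n) \<le> length (enc_vass I)"
    "n \<in> set (snd (inst_target I)) \<Longrightarrow> length (bin n) \<le> length (enc_vass I)"
    "(q, u, q') \<in> set (inst_trans I) \<Longrightarrow> z \<in> set u \<Longrightarrow> length (bin (nat \<bar>z\<bar>)) \<le> length (enc_vass I)"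
    "inst_dim I \<le> length (enc_vass I)"
proof -
  show "n \<in> set (snd (inst_source I)) \<Longrightarrow> length (bin n) \<le> length (enc_vass I)"
    using length_concat_ge[of n "snd (inst_source I)" enc_nat]
    by (simp add: enc_vass_def split_beta del: length_concat)
  show "n \<in> set (snd (inst_target I)) \<Longrightarrow> length (bin n) \<le> length (enc_vass I)"
    using length_concat_ge[of n "snd (inst_target I)" enc_nat]
    by (simp add: enc_vass_def split_beta del: length_concat)
  show "inst_dim I \<le> length (enc_vass I)"
    by (simp add: enc_vass_def split_beta del: length_concat)
  assume t: "(q, u, q') \<in> set (inst_trans I)" and z: "z \<in> set u"
  have "length (bin (nat \<bar>z\<bar>)) \<le> length (enc_int z)" by (simp add: enc_int_def)
  also have "\<dots> \<le> length (concat (map enc_int u))"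
    using length_concat_ge[OF z] .
  also have "\<dots> \<le> length (concat (map (\<lambda>(q, u, q'). VMark # enc_nat q @ concat (map enc_int u) @ enc_nat q')
       (inst_trans I)))"
    using length_concat_ge[OF t, of "\<lambda>(q, u, q'). VMark # enc_nat q @ concat (map enc_int u) @ enc_nat q'"]
    by (simp del: length_concat)
  finally show "length (bin (nat \<bar>z\<bar>)) \<le> length (enc_vass I)"
    by (simp add: enc_vass_def split_beta del: length_concat)
qed

section \<open>Soundness: reading a run off a model\<close>

definition represents :: "nat \<Rightarrow> (name \<Rightarrow> int) \<Rightarrow> nat \<times> (nat \<Rightarrow> nat) \<Rightarrow> bool" where
  "represents N M = (\<lambda>(q, v). (\<forall>q'. M (St q') = of_bool (q' = q)) \<and>
     (\<forall>c. (\<Sum>k\<le>N. 2 ^ k * M (Ct c k)) = int (v c)))"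

lemma sum_effect: "(\<Sum>k\<le>N. 2 ^ k * effect es (Ct c k)) = int (weight N es True c) - int (weight N es False c)"
  by (simp add: effect_def weight_def right_diff_distrib sum_subtractf)

text \<open>Induction over the letters \<open>Blk\<close> from the end of the word. Only the state
  token and the weighted sums are tracked: transition blocks act on them as VASS steps, carry blocks
  leave them unchanged, and the final block forces them to be those of the target.\<close>

lemma run_formula_sound:
  assumes I: "I \<in> vass_instances" and \<sigma>: "\<sigma> \<noteq> []" "holds \<sigma> 0 (run_formula I)"
  shows "(vass_step (vass_of I))\<^sup>*\<^sup>* (conf_of (inst_source I)) (conf_of (inst_target I))"
proof -
  interpret tokens \<sigma>
    using \<sigma>(2) by unfold_locales (auto simp: run_formula_def)
  let ?N = "length (enc_vass I)" and ?V = "vass_of I"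
  obtain qs vs where s: "inst_source I = (qs, vs)" by fastforce
  obtain qt vt where t: "inst_target I = (qt, vt)" by fastforce
  note bounds = bits_bounded[OF I, unfolded s t snd_conv]
  have confs: "conf_of (qs, vs) \<in> vass_confs ?V" using I by (simp add: vass_instances_def s)
  have next_choice: "\<exists>\<phi>\<in>set (chain end_pos (conf_events False (qt, vt)) # map (chain (lit Blk)) (choices I)).
      Suc i < length \<sigma> \<and> holds \<sigma> (Suc i) \<phi>"
    if "i < length \<sigma>" "label \<sigma> i = flags Blk" for i
    using \<sigma>(2) that by (auto simp: run_formula_def t holds_never holds_none_next simp del: flags.simps)
  have reach: "(vass_step ?V)\<^sup>*\<^sup>* (q, v) (conf_of (qt, vt))"
    if "i < length \<sigma>" "label \<sigma> i = flags Blk" "(q, v) \<in> vass_confs ?V" "represents ?N (\<lambda>w. tok \<sigma> w i) (q, v)"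
    for i q v
    using that
  proof (induction "length \<sigma> - i" arbitrary: i q v rule: less_induct)
    case less
    have Suc_i: "tok \<sigma> w (Suc i) = tok \<sigma> w i" for w
      using less.prems by (intro tok_Suc_other) auto
    from next_choice[OF less.prems(1,2)] obtain es where i: "Suc i < length \<sigma>"
      and es: "es = conf_events False (qt, vt) \<and> holds \<sigma> (Suc i) (chain end_pos es) \<or>
        es \<in> set (choices I) \<and> holds \<sigma> (Suc i) (chain (lit Blk) es)"
      by auto
    from es show ?case
    proof (elim disjE conjE)
      assume es: "es = conf_events False (qt, vt)" and "holds \<sigma> (Suc i) (chain end_pos es)"
      from chain_effect[OF i this(2)] obtain j where j: "j < length \<sigma>" "holds \<sigma> j end_pos"
        "\<forall>w. tok \<sigma> w j = tok \<sigma> w (Suc i) + effect es w" by blast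
      from j(1,2) have last: "label \<sigma> j = flags Stop" "Suc j = length \<sigma>"
        by (auto simp: end_pos_def)
      \<comment> \<open>The last letter \<open>Stop\<close> moves no token, so the balance is 0
        already before it.\<close>
      have "tok \<sigma> w j = 0" for w
        using tok_Suc_other[of \<sigma> j w] last tok_length[of w] by simp
      with j(3) Suc_i have tok: "tok \<sigma> w i = - effect es w" for w by (metis add.inverse_unique add.commute)
      have "of_bool (qt = q) = (1 :: int)"
        using less.prems(4) tok[of "St qt"] by (simp add: represents_def effect_def es)
      moreover have "int (v c) = int (vec_of vt c)" for c
      proof -
        have "(\<Sum>k\<le>?N. 2 ^ k * - effect es (Ct c k)) = int (v c)"
          using less.prems(4) by (simp add: represents_def tok)
        then show ?thesis
          using sum_effect[of es c ?N] bounds(2) by (simp add: sum_negf es weight_conf_events)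
      qed
      ultimately have "q = qt" "v = vec_of vt" by (auto split: if_splits)
      then show ?case by (simp add: conf_of_def)
    next
      assume es: "es \<in> set (choices I)" and h: "holds \<sigma> (Suc i) (chain (lit Blk) es)"
      from chain_effect[OF i h] obtain j where j: "j \<ge> Suc i" "j < length \<sigma>" "label \<sigma> j = flags Blk"
        "\<forall>w. tok \<sigma> w j = tok \<sigma> w (Suc i) + effect es w" by (auto simp del: flags.simps)
      have tok: "tok \<sigma> w j = tok \<sigma> w i + effect es w" for w using j(4) Suc_i by simp
      have sum: "(\<Sum>k\<le>?N. 2 ^ k * tok \<sigma> (Ct c k) j) =
          int (v c) + int (weight ?N es True c) - int (weight ?N es False c)" for c
        using less.prems(4) sum_effect[of es c ?N]
        by (simp add: tok represents_def distrib_left sum.distrib)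
      from es consider a u b where "(a, u, b) \<in> set (inst_trans I)" "es = trans_events (a, u, b)"
        | "es \<in> set (carry_events ?N)"
        by (auto simp: choices_def)
      then show ?case
      proof cases
        case 1
        \<comment> \<open>Nonnegative balances turn the sums after the block into counter
          values.\<close>
        have "0 \<le> (\<Sum>k\<le>?N. 2 ^ k * tok \<sigma> (Ct c k) j)" for c
          by (intro sum_nonneg mult_nonneg_nonneg tok_nonneg) auto
        moreover define v' where "v' c = nat (\<Sum>k\<le>?N. 2 ^ k * tok \<sigma> (Ct c k) j)" for c
        ultimately have v': "(\<Sum>k\<le>?N. 2 ^ k * tok \<sigma> (Ct c k) j) = int (v' c)" for c
          by simp
        \<comment> \<open>The block consumes the token of \<open>a\<close> first. A nonnegative
          balance afterwards shows that it was present, and only \<open>q\<close> has a state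
          token.\<close>
        have "tok \<sigma> (St a) (Suc (Suc i)) = tok \<sigma> (St a) (Suc i) - 1"
          using tok_dec[OF i h[unfolded 1(2) trans_events_def prod.case append_Cons]] by simp
        with tok_nonneg[of "St a" "Suc (Suc i)"] Suc_i have "1 \<le> tok \<sigma> (St a) i" by simp
        with less.prems(4) have a: "a = q" by (cases "a = q") (auto simp: represents_def)
        have wt: "int (v' c) = int (v c) + vec_of u c" for c
          using sum[of c] bounds(3)[OF 1(1)] by (simp add: v' 1(2) weight_trans_events)
        have tr: "(q, vec_of u, b) \<in> trans ?V"
          using 1(1) by (force simp: vass_of_def a)
        have V: "vass ?V" using I by (simp add: vass_instances_def)
        have u: "vec_of u c = 0" if "c \<notin> counters ?V" for c
          using V tr that by (auto simp: vass_def)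
        have "v' c = 0" if "c \<notin> counters ?V" for c
          using wt[of c] u[OF that] less.prems(3) that by (auto simp: vass_confs_def)
        with V tr have c': "(b, v') \<in> vass_confs ?V"
          by (auto simp: vass_confs_def vass_def)
        have "vass_step ?V (q, v) (b, v')"
          using tr wt c' less.prems(3) by (auto simp: vass_step_def)
        moreover have "represents ?N (\<lambda>w. tok \<sigma> w j) (b, v')"
          using less.prems(4) v' by (auto simp: represents_def tok[of "St _"] effect_def 1(2) a)
        ultimately show ?thesis
          using less.hyps[of j b v'] j i c' by (auto intro: converse_rtranclp_into_rtranclp)
      next
        case 2
        have "represents ?N (\<lambda>w. tok \<sigma> w j) (q, v)"
          using less.prems(4) sum by (auto simp: represents_def tok effect_def count_carry_events_St[OF 2] weight_carry_events[OF 2])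
        then show ?thesis using less.hyps[of j q v] j i less.prems(3) by auto
      qed
    qed
  qed
  have "holds \<sigma> 0 (chain (lit Blk) (conf_events True (qs, vs)))"
    using \<sigma>(2) by (simp add: run_formula_def s)
  from chain_effect[OF _ this] \<sigma>(1) obtain j where j: "j < length \<sigma>" "label \<sigma> j = flags Blk"
    "\<forall>w. tok \<sigma> w j = effect (conf_events True (qs, vs)) w" by (auto simp del: flags.simps)
  then have "represents ?N (\<lambda>w. tok \<sigma> w j) (qs, vec_of vs)"
    using bounds(1) by (auto simp: represents_def sum_effect weight_conf_events) (auto simp: effect_def)
  with reach[OF j(1,2), of qs "vec_of vs"] confs show ?thesis
    by (simp add: conf_of_def s t)
qed

section \<open>From runs to models\<close>

fun fire :: "(name \<Rightarrow> nat) \<Rightarrow> event list \<Rightarrow> (name \<Rightarrow> nat) \<Rightarrow> bool" where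
  "fire M [] M' \<longleftrightarrow> M = M'"
| "fire M ((True, w) # es) M' \<longleftrightarrow> fire (M(w := Suc (M w))) es M'"
| "fire M ((False, w) # es) M' \<longleftrightarrow> 0 < M w \<and> fire (M(w := M w - 1)) es M'"

text \<open>If every token to be consumed is present at the outset, no order of the events can
  block, and mere counting gives the result.\<close>

lemma fire_enough:
  assumes "\<forall>w. count_list es (False, w) \<le> M w"
  shows "fire M es (\<lambda>w. M w + count_list es (True, w) - count_list es (False, w))"
  using assms
proof (induction es arbitrary: M)
  case (Cons e es)
  obtain s v where e: "e = (s, v)" by fastforce
  show ?case
  proof (cases s)
    case True
    have le: "\<forall>w. count_list es (False, w) \<le> (M(v := Suc (M v))) w"
      using Cons.prems by (auto simp: e True le_SucI)
    have eq: "(\<lambda>w. (M(v := Suc (M v))) w + count_list es (True, w) - count_list es (False, w)) =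
        (\<lambda>w. M w + count_list (e # es) (True, w) - count_list (e # es) (False, w))"
      by (auto simp: e True)
    from Cons.IH[OF le] have "fire (M(v := Suc (M v))) es
        (\<lambda>w. M w + count_list (e # es) (True, w) - count_list (e # es) (False, w))"
      by (simp only: eq)
    then show ?thesis by (simp only: e True fire.simps)
  next
    case False
    have le: "count_list es (False, w) + of_bool (w = v) \<le> M w" for w
      using Cons.prems[rule_format, of w] by (auto simp: e False)
    then have le': "\<forall>w. count_list es (False, w) \<le> (M(v := M v - 1)) w"
      using le[of v] by (auto intro: order_trans[OF le_add1])
    have eq: "(\<lambda>w. (M(v := M v - 1)) w + count_list es (True, w) - count_list es (False, w)) =
        (\<lambda>w. M w + count_list (e # es) (True, w) - count_list (e # es) (False, w))"
      using le[of v] by (intro ext) (auto simp: e False)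
    from Cons.IH[OF le'] have "fire (M(v := M v - 1)) es
        (\<lambda>w. M w + count_list (e # es) (True, w) - count_list (e # es) (False, w))"
      by (simp only: eq)
    moreover have "0 < M v" using le[of v] by simp
    ultimately show ?thesis by (simp only: e False fire.simps)
  qed
qed simp

text \<open>An \<open>Inc\<close> or \<open>Dec\<close> remembers the name of its token; all other
  letters, including those that spell names, carry \<open>None\<close>.\<close>

type_synonym posn = "letter \<times> name option"

fun piece :: "event \<Rightarrow> posn list" where
  "piece (True, w) = (Inc, Some w) # map (\<lambda>a. (a, None)) (word w)"
| "piece (False, w) = [(Dec, Some w)]"

definition play :: "event list \<Rightarrow> posn list" where
  "play es = concat (map piece es)"

lemma play_simps [simp]: "play [] = []" "play (e # es) = piece e @ play es"
  by (simp_all add: play_def)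

fun legal :: "(name \<Rightarrow> nat) \<Rightarrow> posn list \<Rightarrow> bool" where
  "legal M [] \<longleftrightarrow> (\<forall>w. M w = 0)"
| "legal M ((Inc, Some w) # P) \<longleftrightarrow> legal (M(w := Suc (M w))) P"
| "legal M ((Dec, Some w) # P) \<longleftrightarrow> 0 < M w \<and> legal (M(w := M w - 1)) P"
| "legal M (_ # P) \<longleftrightarrow> legal M P"

lemma legal_None [simp]: "legal M ((a, None) # P) = legal M P"
  by (cases a) auto

lemma legal_word [simp]: "legal M (map (\<lambda>a. (a, None)) as @ P) = legal M P"
  by (induction as) auto

lemma fire_legal: "fire M es M' \<Longrightarrow> legal M' P \<Longrightarrow> legal M (play es @ P)"
  by (induction M es M' rule: fire.induct) auto

text \<open>The prefix inequality will find an earlier increment for each decrement, the total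
  equality a decrement for each increment.\<close>

lemma legal_counts:
  assumes "legal M P"
  shows "count_list (take i P) (Dec, Some w) \<le> M w + count_list (take i P) (Inc, Some w)"
    "count_list P (Dec, Some w) = M w + count_list P (Inc, Some w)"
proof -
  have "count_list (take i P) (Dec, Some w) \<le> M w + count_list (take i P) (Inc, Some w) \<and>
    count_list P (Dec, Some w) = M w + count_list P (Inc, Some w)"
    using assms
  proof (induction M P arbitrary: i rule: legal.induct)
    case (2 M v P)
    from "2.IH" "2.prems" have IH: "count_list (take i P) (Dec, Some w) \<le> (M(v := Suc (M v))) w + count_list (take i P) (Inc, Some w) \<and>
      count_list P (Dec, Some w) = (M(v := Suc (M v))) w + count_list P (Inc, Some w)" for i
      by (simp del: fun_upd_apply)
    from IH[of "i - 1"] show ?case by (cases i) (auto split: if_splits)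
  next
    case (3 M v P)
    from "3.IH" "3.prems" have IH: "count_list (take i P) (Dec, Some w) \<le> (M(v := M v - 1)) w + count_list (take i P) (Inc, Some w) \<and>
      count_list P (Dec, Some w) = (M(v := M v - 1)) w + count_list P (Inc, Some w)" for i
      by (simp del: fun_upd_apply)
    from IH[of "i - 1"] "3.prems" show ?case by (cases i) (auto split: if_splits)
  qed (auto simp: take_Cons' split: if_splits)
  then show "count_list (take i P) (Dec, Some w) \<le> M w + count_list (take i P) (Inc, Some w)"
    "count_list P (Dec, Some w) = M w + count_list P (Inc, Some w)" by auto
qed

text \<open>The nonempty rest \<open>R\<close> supplies the position that \<open>produced\<close>
  demands after the word.\<close>

primrec spelled :: "posn list \<Rightarrow> bool" where
  "spelled [] \<longleftrightarrow> True"
| "spelled (x # P) \<longleftrightarrow> spelled P \<and> (fst x \<in> {Inc, Dec} \<longrightarrow> snd x \<noteq> None) \<and>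
     (\<forall>w. x = (Inc, Some w) \<longrightarrow> (\<exists>R. R \<noteq> [] \<and> P = map (\<lambda>a. (a, None)) (word w) @ R))"

lemma spelled_drop: "spelled P \<Longrightarrow> spelled (drop p P)"
  by (induction P arbitrary: p) (auto simp: drop_Cons')

lemma spelled_word: "spelled P \<Longrightarrow> Inc \<notin> set as \<Longrightarrow> Dec \<notin> set as \<Longrightarrow> spelled (map (\<lambda>a. (a, None)) as @ P)"
  by (induction as) auto

lemma spelled_play: "spelled P \<Longrightarrow> P \<noteq> [] \<Longrightarrow> spelled (play es @ P)"
proof (induction es)
  case (Cons e es)
  then show ?case
    by (cases e rule: piece.cases) (auto simp: spelled_word word_letters intro!: exI[of _ "play es @ P"])
qed simp

instance name :: countable
  by countable_datatype

text \<open>The n-th increment and the n-th decrement of a name get the same datum.\<close>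

definition datum :: "posn list \<Rightarrow> nat \<Rightarrow> nat" where
  "datum P i = to_nat (snd (P ! i), count_list (take i P) (P ! i))"

text \<open>\<open>Suc d\<close> is merely some value other than \<open>d\<close>. Across positions
  only variable 0 is ever compared, so a coincidence with another datum does no harm.\<close>

definition valuation :: "nat \<Rightarrow> bool \<times> bool \<times> bool \<Rightarrow> var \<Rightarrow> nat" where
  "valuation d = (\<lambda>(f, g, h) x. if x = 0 \<or> x = 1 \<and> f \<or> x = 2 \<and> g \<or> x = 3 \<and> h then d else Suc d)"

definition model_of :: "posn list \<Rightarrow> model" where
  "model_of P = map (\<lambda>i. valuation (datum P i) (flags (fst (P ! i)))) [0..<length P]"

lemma length_model_of [simp]: "length (model_of P) = length P"
  by (simp add: model_of_def)

lemma model_of_0 [simp]: "i < length P \<Longrightarrow> (model_of P ! i) 0 = datum P i"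
  by (simp add: model_of_def valuation_def split: prod.split)

lemma label_model_of [simp]: "i < length P \<Longrightarrow> label (model_of P) i = flags (fst (P ! i))"
  by (cases "flags (fst (P ! i))") (simp add: label_def model_of_def valuation_def)

lemma count_list_take_Suc:
  "i < length P \<Longrightarrow> count_list (take (Suc i) P) x = count_list (take i P) x + of_bool (P ! i = x)"
  by (simp add: take_Suc_conv_app_nth)

lemma count_list_take_mono: "i \<le> j \<Longrightarrow> count_list (take i P) x \<le> count_list (take j P) x"
  by (metis count_list_append le_add1 le_add_diff_inverse take_add)

lemma nth_occurrence:
  "m < count_list P x \<Longrightarrow> \<exists>p<length P. P ! p = x \<and> count_list (take p P) x = m"
proof (induction P arbitrary: m)
  case (Cons y P)
  show ?case
  proof (cases "y = x")
    case True
    show ?thesis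
    proof (cases m)
      case 0
      with True show ?thesis by (intro exI[of _ 0]) auto
    next
      case (Suc m')
      with Cons True obtain p where "p < length P" "P ! p = x" "count_list (take p P) x = m'" by auto
      with Suc True show ?thesis by (intro exI[of _ "Suc p"]) auto
    qed
  next
    case False
    with Cons obtain p where "p < length P" "P ! p = x" "count_list (take p P) x = m" by auto
    with False show ?thesis by (intro exI[of _ "Suc p"]) auto
  qed
qed simp

section \<open>The model of a legal word\<close>

locale play_model =
  fixes P :: "posn list"
  assumes legal: "legal (\<lambda>_. 0) P" and spelled: "spelled P"
begin

lemma tagged: "i < length P \<Longrightarrow> fst (P ! i) \<in> {Inc, Dec} \<Longrightarrow> \<exists>w. P ! i = (fst (P ! i), Some w)"
  using spelled_drop[OF spelled, of i] by (cases "P ! i") (auto simp: Cons_nth_drop_Suc[symmetric])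

text \<open>Equal letters with equal data would be the same symbol with the same occurrence number,
  but that number grows strictly from one occurrence to the next.\<close>

lemma datum_neq:
  assumes "p < p'" "p' < length P" "fst (P ! p) = fst (P ! p')"
  shows "datum P p \<noteq> datum P p'"
proof
  assume "datum P p = datum P p'"
  then have "snd (P ! p) = snd (P ! p')" "count_list (take p P) (P ! p) = count_list (take p' P) (P ! p')"
    by (simp_all add: datum_def)
  moreover from this assms(3) have "P ! p = P ! p'" by (simp add: prod_eq_iff)
  ultimately show False
    using count_list_take_mono[of "Suc p" p' P "P ! p"] count_list_take_Suc[of p P "P ! p"] assms by simp
qed

text \<open>Let the decrement have number \<open>m\<close>, counted from 0. The prefix inequality
  just after it gives more than \<open>m\<close> increments before it, so number \<open>m\<close> is
  among them.\<close>

lemma past_inc: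
  assumes "q < length P" "P ! q = (Dec, Some w)"
  shows "\<exists>p<q. P ! p = (Inc, Some w) \<and> datum P p = datum P q"
proof -
  have "count_list (take q P) (Dec, Some w) < count_list (take q P) (Inc, Some w)"
    using legal_counts(1)[OF legal, of "Suc q" w] assms by (simp add: count_list_take_Suc)
  from nth_occurrence[OF this] obtain p where "p < q" "P ! p = (Inc, Some w)"
    "count_list (take p P) (Inc, Some w) = count_list (take q P) (Dec, Some w)"
    using assms(1) by auto
  with assms show ?thesis by (auto simp: datum_def)
qed

text \<open>The total equality provides the decrement with the same number. It cannot come first:
  the prefix inequality just after it would put too many increments before \<open>p\<close>.\<close>

lemma future_dec:
  assumes "p < length P" "P ! p = (Inc, Some w)"
  shows "\<exists>q>p. q < length P \<and> P ! q = (Dec, Some w) \<and> datum P q = datum P p"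
proof -
  let ?m = "count_list (take p P) (Inc, Some w)"
  have "?m < count_list P (Dec, Some w)"
    using legal_counts(2)[OF legal, of w] count_list_take_mono[of "Suc p" "length P" P "(Inc, Some w)"] assms
    by (simp add: count_list_take_Suc)
  from nth_occurrence[OF this] obtain q where q: "q < length P" "P ! q = (Dec, Some w)"
    "count_list (take q P) (Dec, Some w) = ?m" by auto
  have "p < q"
  proof (rule ccontr)
    assume "\<not> p < q"
    with q(2) assms(2) have "q < p" by (cases "p = q") auto
    then have "count_list (take (Suc q) P) (Inc, Some w) \<le> ?m"
      by (intro count_list_take_mono) auto
    with legal_counts(1)[OF legal, of "Suc q" w] q show False
      by (simp add: count_list_take_Suc)
  qed
  with q assms show ?thesis by (auto simp: datum_def)
qed

lemma holds_data:
  "holds (model_of P) 0 inc_once" "holds (model_of P) 0 dec_once" "holds (model_of P) 0 inc_used"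
proof -
  have "\<not> holds (model_of P) p (And (lit a) (EqFut 0 (lit a) 0))" if "p < length P" for p a
  proof
    assume "holds (model_of P) p (And (lit a) (EqFut 0 (lit a) 0))"
    then obtain j where "p < j" "j < length P" "fst (P ! p) = a" "fst (P ! j) = a" "datum P p = datum P j"
      using that by (auto simp del: flags.simps)
    with datum_neq[of p j] show False by simp
  qed
  then show "holds (model_of P) 0 inc_once" "holds (model_of P) 0 dec_once"
    by (simp_all only: inc_once_def dec_once_def holds_never length_model_of) blast+
  have "\<exists>q>p. q < length P \<and> datum P p = datum P q \<and> fst (P ! q) = Dec"
    if "p < length P" "fst (P ! p) = Inc" for p
    using tagged[of p] future_dec[of p] that by (metis fst_conv insertI1)
  then have "\<not> holds (model_of P) p (And (lit Inc) (Neg (EqFut 0 (lit Dec) 0)))" if "p < length P" for p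
    using that by (fastforce simp del: flags.simps)
  then show "holds (model_of P) 0 inc_used"
    by (simp only: inc_used_def holds_never length_model_of) blast
qed

lemma holds_spelling:
  assumes "drop p P = Q @ R" "R \<noteq> []" "map fst Q = as"
  shows "holds (model_of P) p (spell as \<psi>) \<longleftrightarrow> holds (model_of P) (p + length as) \<psi>"
proof -
  have "length (drop p P) = length as + length R"
    using assms by (metis length_append length_map)
  moreover have "length R \<noteq> 0" using assms(2) by simp
  ultimately have len: "p + length as < length P" by (auto; linarith)
  have "fst (P ! (p + j)) = as ! j" if "j < length as" for j
  proof -
    have "P ! (p + j) = drop p P ! j" using len by simp
    with that assms(3) show ?thesis by (auto simp: assms(1) nth_append)
  qed
  with len show ?thesis by (simp add: holds_spell)
qed

lemma holds_produced:
  assumes "p < length P" "P ! p = (Inc, Some w)"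
  shows "holds (model_of P) p (produced w)"
proof -
  from spelled_drop[OF spelled, of p] assms obtain R where R: "R \<noteq> []"
    "drop p P = piece (True, w) @ R"
    by (auto simp: Cons_nth_drop_Suc[symmetric])
  then have "length (drop p P) = Suc (length (word w)) + length R" by simp
  moreover have "length R \<noteq> 0" using R(1) by simp
  ultimately have "p + Suc (length (word w)) < length P" by (auto; linarith)
  then show ?thesis
    unfolding produced_def using holds_spelling[OF R(2,1)] by (simp add: comp_def del: spell.simps)
qed

text \<open>Beyond the letters themselves, the only obligation is the \<open>EqPast\<close> of a
  decrement, which \<open>past_inc\<close> meets.\<close>

lemma holds_chain:
  assumes "drop p P = play es @ R" "R \<noteq> []" "holds (model_of P) (p + length (play es)) \<tau>"
  shows "holds (model_of P) p (chain \<tau> es)"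
  using assms
proof (induction \<tau> es arbitrary: p rule: chain.induct)
  case (2 \<tau> w es)
  from 2(2) have "drop p P = piece (True, w) @ (play es @ R)" by simp
  from holds_spelling[OF this, of "Inc # word w"] 2(3)
  have *: "holds (model_of P) p (chain \<tau> ((True, w) # es)) =
      holds (model_of P) (p + length (Inc # word w)) (chain \<tau> es)"
    by (simp add: comp_def del: spell.simps)
  have "drop (length (piece (True, w))) (drop p P) = play es @ R"
    unfolding 2(2) by simp
  then have "drop (p + length (Inc # word w)) P = play es @ R"
    by (simp add: add.commute)
  from 2(1)[OF this 2(3)] 2(4) show ?case
    unfolding * by (simp add: add.assoc)
next
  case (3 \<tau> w es)
  from 3(2) have d: "drop p P = (Dec, Some w) # play es @ R" by simp
  then have p: "p < length P" by (metis drop_eq_Nil linorder_not_less list.distinct(1))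
  have Pp: "P ! p = (Dec, Some w)" using nth_via_drop[OF d] .
  have d': "drop (Suc p) P = play es @ R" using d by (simp add: drop_Suc tl_drop[symmetric])
  with 3(3) have "Suc p < length P" by (metis Nil_is_append_conv drop_eq_Nil linorder_not_less)
  moreover from 3(1)[OF d' 3(3)] 3(4) have "holds (model_of P) (Suc p) (chain \<tau> es)" by simp
  moreover from past_inc[OF p Pp] p
  have "\<exists>j<p. (model_of P ! p) 0 = (model_of P ! j) 0 \<and> holds (model_of P) j (produced w)"
    by (auto intro!: holds_produced)
  ultimately show ?case using p Pp by simp
qed simp

end

text \<open>Words are assembled from the back: \<open>P\<close> is a suffix that starts at a
  \<open>Blk\<close> and can be played from the marking \<open>M\<close> down to the empty
  one.\<close>

inductive ending :: "vass_inst \<Rightarrow> (name \<Rightarrow> nat) \<Rightarrow> posn list \<Rightarrow> bool" for I where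
  target: "fire M (conf_events False (inst_target I)) (\<lambda>_. 0) \<Longrightarrow>
    ending I M ((Blk, None) # play (conf_events False (inst_target I)) @ [(Stop, None)])"
| choice: "es \<in> set (choices I) \<Longrightarrow> fire M es M' \<Longrightarrow> ending I M' P \<Longrightarrow>
    ending I M ((Blk, None) # play es @ P)"

lemma ending_Blk: "ending I M P \<Longrightarrow> \<exists>P'. P = (Blk, None) # P'"
  by (induction rule: ending.induct) auto

lemma ending_legal: "ending I M P \<Longrightarrow> legal M P"
  by (induction rule: ending.induct) (auto intro: fire_legal)

lemma ending_spelled: "ending I M P \<Longrightarrow> spelled P"
  by (induction rule: ending.induct) (auto intro!: spelled_play dest: ending_Blk)

lemma play_no_Blk: "x \<in> set (play es) \<Longrightarrow> fst x \<noteq> Blk"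
proof (induction es)
  case (Cons e es)
  have "Blk \<notin> set (word w)" for w by (cases w) auto
  with Cons show ?case by (cases e rule: piece.cases) auto
qed simp

text \<open>Events contain no \<open>Blk\<close>, so this letter occurs only where a block
  begins.\<close>

lemma ending_block:
  assumes "ending I M P" "i < length P" "fst (P ! i) = Blk"
  shows "\<exists>es R. drop (Suc i) P = play es @ R \<and>
    (es \<in> set (choices I) \<and> (\<exists>R'. R = (Blk, None) # R') \<or>
     es = conf_events False (inst_target I) \<and> R = [(Stop, None)])"
  using assms
proof (induction arbitrary: i rule: ending.induct)
  case (target M)
  show ?case
  proof (cases i)
    case (Suc j)
    let ?Q = "play (conf_events False (inst_target I))"
    from target.prems Suc have "fst ((?Q @ [(Stop, None)]) ! j) = Blk" "j < Suc (length ?Q)" by auto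
    moreover have "fst (?Q ! j) \<noteq> Blk" if "j < length ?Q" using play_no_Blk that nth_mem by blast
    ultimately show ?thesis by (auto simp: nth_append less_Suc_eq split: if_splits)
  qed auto
next
  case (choice es M M' P)
  show ?case
  proof (cases i)
    case 0
    with choice.hyps ending_Blk[OF choice.hyps(3)] show ?thesis by auto
  next
    case (Suc j)
    have "\<not> j < length (play es)"
      using choice.prems play_no_Blk[of "play es ! j" es] by (auto simp: Suc nth_append)
    with choice.prems choice.IH[of "j - length (play es)"] show ?thesis
      by (auto simp: Suc nth_append Suc_diff_le)
  qed
qed

lemma ending_satisfiable:
  assumes "fire (\<lambda>_. 0) (conf_events True (inst_source I)) M" "ending I M T"
  shows "satisfiable (run_formula I)"
proof -
  define P where "P = play (conf_events True (inst_source I)) @ T"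
  let ?\<sigma> = "model_of P" and ?n = "length (play (conf_events True (inst_source I)))"
  obtain T' where T: "T = (Blk, None) # T'" using ending_Blk[OF assms(2)] by blast
  interpret play_model P
    using fire_legal[OF assms(1) ending_legal[OF assms(2)]] spelled_play[OF ending_spelled[OF assms(2)]]
    by unfold_locales (simp_all add: P_def T)
  have src: "holds ?\<sigma> 0 (chain (lit Blk) (conf_events True (inst_source I)))"
    by (rule holds_chain[of _ _ T]) (auto simp: P_def T nth_append)
  have "holds ?\<sigma> 0 (never (And (lit Blk) (none_next (chain end_pos (conf_events False (inst_target I)) #
      map (chain (lit Blk)) (choices I)))))"
    unfolding holds_never
  proof (intro allI impI)
    fix i assume i: "i < length ?\<sigma>"
    have "\<exists>\<phi>\<in>set (chain end_pos (conf_events False (inst_target I)) # map (chain (lit Blk)) (choices I)).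
        Suc i < length P \<and> holds ?\<sigma> (Suc i) \<phi>" if blk: "fst (P ! i) = Blk"
    proof -
      \<comment> \<open>The play of the source contains no \<open>Blk\<close>, so the position lies
        in \<open>T\<close>.\<close>
      have "?n \<le> i"
        using i blk play_no_Blk[of "P ! i" "conf_events True (inst_source I)"]
        by (auto simp: P_def nth_append not_le[symmetric] split: if_splits)
      then have Ti: "T ! (i - ?n) = P ! i" "drop (Suc i) P = drop (Suc (i - ?n)) T" "i - ?n < length T"
        using i by (auto simp: P_def nth_append Suc_diff_le)
      from ending_block[OF assms(2) Ti(3)] blk Ti obtain es R where R: "drop (Suc i) P = play es @ R"
        and es: "es \<in> set (choices I) \<and> (\<exists>R'. R = (Blk, None) # R') \<or>
          es = conf_events False (inst_target I) \<and> R = [(Stop, None)]" by auto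
      let ?j = "Suc i + length (play es)"
      have "R \<noteq> []" using es by auto
      have "length (drop (Suc i) P) = length (play es) + length R" using R by simp
      with \<open>R \<noteq> []\<close> have j: "?j < length P" "length P = ?j + length R" by (auto; cases R; simp)+
      have "drop (length (play es)) (drop (Suc i) P) = R" unfolding R by simp
      then have "drop ?j P = R" by (simp add: add.commute)
      then have "P ! ?j = hd R" using hd_drop_conv_nth[OF j(1)] by simp
      from es show ?thesis
      proof
        assume c: "es \<in> set (choices I) \<and> (\<exists>R'. R = (Blk, None) # R')"
        with j(1) \<open>P ! ?j = hd R\<close> have "holds ?\<sigma> ?j (lit Blk)" by auto
        with holds_chain[OF R \<open>R \<noteq> []\<close>] c j show ?thesis by fastforce
      next
        assume e: "es = conf_events False (inst_target I) \<and> R = [(Stop, None)]"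
        with j \<open>P ! ?j = hd R\<close> have "holds ?\<sigma> ?j end_pos" by (auto simp: end_pos_def)
        with holds_chain[OF R \<open>R \<noteq> []\<close>] e j show ?thesis by auto
      qed
    qed
    with i show "\<not> holds ?\<sigma> i (And (lit Blk) (none_next (chain end_pos (conf_events False (inst_target I)) #
        map (chain (lit Blk)) (choices I))))"
      by (auto simp: holds_none_next simp del: none_next.simps flags.simps)
  qed
  with src holds_data have "holds ?\<sigma> 0 (run_formula I)" by (simp add: run_formula_def)
  moreover have "?\<sigma> \<noteq> []" by (simp add: T P_def flip: length_greater_0_conv)
  ultimately show ?thesis unfolding satisfiable_def by blast
qed

section \<open>Rearranging tokens by splits and merges\<close>

text \<open>Tokens above level \<open>N\<close> are excluded so that splits, which reach down from
  level \<open>N\<close> at most, can bring every token to level 0.\<close>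

definition marks :: "nat \<Rightarrow> (name \<Rightarrow> nat) \<Rightarrow> nat \<times> (nat \<Rightarrow> nat) \<Rightarrow> bool" where
  "marks N M = (\<lambda>(q, v). (\<forall>q'. M (St q') = of_bool (q' = q)) \<and>
     (\<forall>c. (\<Sum>k\<le>N. 2 ^ k * M (Ct c k)) = v c) \<and> (\<forall>c k. N < k \<longrightarrow> M (Ct c k) = 0))"

definition split_step :: "nat \<Rightarrow> (name \<Rightarrow> nat) \<Rightarrow> (name \<Rightarrow> nat) \<Rightarrow> bool" where
  "split_step N M M' \<longleftrightarrow> (\<exists>c<N. \<exists>k<N. 0 < M (Ct c (Suc k)) \<and>
     M' = M(Ct c (Suc k) := M (Ct c (Suc k)) - 1, Ct c k := M (Ct c k) + 2))"

lemma split_step_fire: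
  assumes "split_step N M M'"
  shows "\<exists>es\<in>set (carry_events N). fire M es M'" "\<exists>es\<in>set (carry_events N). fire M' es M"
proof -
  from assms obtain c k where ck: "c < N" "k < N" "0 < M (Ct c (Suc k))"
    "M' = M(Ct c (Suc k) := M (Ct c (Suc k)) - 1, Ct c k := M (Ct c k) + 2)"
    by (auto simp: split_step_def)
  then have "fire M (split_events c k) M'" "fire M' (merge_events c k) M"
    by (auto simp: split_events_def merge_events_def fun_eq_iff)
  moreover have "split_events c k \<in> set (carry_events N)" "merge_events c k \<in> set (carry_events N)"
    using ck by (auto simp: set_carry_events)
  ultimately show "\<exists>es\<in>set (carry_events N). fire M es M'" "\<exists>es\<in>set (carry_events N). fire M' es M"
    by blast+
qed

text \<open>Each link of the zigzag is fired as a split or as the merge that undoes one, and is put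
  in front of the word as a block.\<close>

lemma ending_split:
  assumes "equivclp (split_step (length (enc_vass I))) M M'" "ending I M' P"
  shows "\<exists>P. ending I M P"
  using assms
proof (induction rule: converse_equivclp_induct)
  case (step M M'')
  then obtain P' where P': "ending I M'' P'" by blast
  from step.hyps(1) have "\<exists>es\<in>set (carry_events (length (enc_vass I))). fire M es M''"
    using split_step_fire by blast
  then obtain es where "es \<in> set (choices I)" "fire M es M''" by (auto simp: choices_def)
  with P' show ?case by (blast intro: ending.choice)
qed blast

definition canonical :: "nat \<times> (nat \<Rightarrow> nat) \<Rightarrow> name \<Rightarrow> nat" where
  "canonical = (\<lambda>(q, v) w. case w of St q' \<Rightarrow> of_bool (q' = q) | Ct c k \<Rightarrow> if k = 0 then v c else 0)"

text \<open>Each split adds one token while the weighted sums stay fixed and bound the number of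
  tokens; the measure is the remaining gap. When no split applies, everything lies at level
  0.\<close>

lemma marks_canonical:
  assumes "marks N M (q, v)" "\<forall>c\<ge>N. v c = 0"
  shows "(split_step N)\<^sup>*\<^sup>* M (canonical (q, v))"
  using assms(1)
proof (induction "(\<Sum>c<N. v c) - (\<Sum>(c, k)\<in>{..<N} \<times> {..N}. M (Ct c k))" arbitrary: M rule: less_induct)
  case less
  show ?case
  proof (cases "\<exists>c<N. \<exists>k<N. 0 < M (Ct c (Suc k))")
    case True
    then obtain c k where ck: "c < N" "k < N" "0 < M (Ct c (Suc k))" by blast
    define M' where "M' = M(Ct c (Suc k) := M (Ct c (Suc k)) - 1, Ct c k := M (Ct c k) + 2)"
    have step: "split_step N M M'" using ck by (auto simp: split_step_def M'_def)
    have M': "int (M' (Ct c' k')) = int (M (Ct c' k')) + (if (c', k') = (c, k) then 2 else 0)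
        - (if (c', k') = (c, Suc k) then 1 else 0)" for c' k'
      using ck by (auto simp: M'_def)
    have "int (\<Sum>k\<le>N. 2 ^ k * M' (Ct c' k)) = int (\<Sum>k\<le>N. 2 ^ k * M (Ct c' k))" for c'
    proof (cases "c' = c")
      case True
      have "int (\<Sum>k\<le>N. 2 ^ k * M' (Ct c' k)) = (\<Sum>k'\<le>N. 2 ^ k' * int (M (Ct c' k')) +
          (if k' = k then 2 * 2 ^ k else 0) - (if k' = Suc k then 2 ^ Suc k else 0))"
        unfolding of_nat_sum of_nat_mult M' by (intro sum.cong) (auto simp: True algebra_simps)
      also have "\<dots> = int (\<Sum>k\<le>N. 2 ^ k * M (Ct c' k))"
        using ck by (simp add: sum.distrib sum_subtractf)
      finally show ?thesis .
    next
      case False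
      then show ?thesis by (simp add: M'_def)
    qed
    then have "(\<Sum>k\<le>N. 2 ^ k * M' (Ct c' k)) = (\<Sum>k\<le>N. 2 ^ k * M (Ct c' k))" for c'
      by (metis of_nat_eq_iff)
    moreover have "M' (St q') = M (St q')" "N < k' \<Longrightarrow> M' (Ct c' k') = M (Ct c' k')" for q' c' k'
      using ck by (auto simp: M'_def)
    ultimately have marks': "marks N M' (q, v)"
      using less.prems by (simp add: marks_def)
    have "int (\<Sum>(c, k)\<in>{..<N} \<times> {..N}. M' (Ct c k)) = (\<Sum>p\<in>{..<N} \<times> {..N}. int (M (Ct (fst p) (snd p))) +
        (if p = (c, k) then 2 else 0) - (if p = (c, Suc k) then 1 else 0))"
      unfolding of_nat_sum by (intro sum.cong refl) (simp only: split_beta M' prod.collapse)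
    also have "\<dots> = int (\<Sum>(c, k)\<in>{..<N} \<times> {..N}. M (Ct c k)) + 1"
      using ck by (simp add: sum.distrib sum_subtractf split_beta)
    finally have more: "(\<Sum>(c, k)\<in>{..<N} \<times> {..N}. M' (Ct c k)) = Suc (\<Sum>(c, k)\<in>{..<N} \<times> {..N}. M (Ct c k))"
      by linarith
    have "(\<Sum>(c, k)\<in>{..<N} \<times> {..N}. M' (Ct c k)) = (\<Sum>c<N. \<Sum>k\<le>N. M' (Ct c k))"
      by (simp add: sum.cartesian_product)
    also have "\<dots> \<le> (\<Sum>c<N. \<Sum>k\<le>N. 2 ^ k * M' (Ct c k))"
      by (intro sum_mono) simp
    also have "\<dots> = (\<Sum>c<N. v c)" using marks' by (simp add: marks_def)
    finally have "(split_step N)\<^sup>*\<^sup>* M' (canonical (q, v))"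
      using more by (intro less.hyps marks') linarith
    with step show ?thesis by (rule converse_rtranclp_into_rtranclp)
  next
    case False
    \<comment> \<open>For \<open>c\<close> and \<open>k\<close> below \<open>N\<close> by the case
      assumption; a counter from \<open>N\<close> on has value 0 and hence no tokens; levels above
      \<open>N\<close> are empty by \<open>marks\<close>.\<close>
    have zero: "M (Ct c (Suc k)) = 0" for c k
    proof (cases "c < N \<and> k < N")
      case True
      with False show ?thesis by auto
    next
      case not: False
      show ?thesis
      proof (cases "k < N")
        case True
        with not have "c \<ge> N" by simp
        with assms(2) less.prems have "(\<Sum>k\<le>N. 2 ^ k * M (Ct c k)) = 0" by (simp add: marks_def)
        with True show ?thesis by (auto simp: Suc_le_eq)
      qed (use less.prems in \<open>auto simp: marks_def\<close>)
    qed
    have "M (Ct c 0) = v c" for c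
    proof -
      have "(\<Sum>k\<le>N. 2 ^ k * M (Ct c k)) = M (Ct c 0)"
        by (subst sum.atMost_shift) (simp add: zero)
      with less.prems show ?thesis by (simp add: marks_def)
    qed
    then have "M w = canonical (q, v) w" for w
      using less.prems by (cases w; cases "case w of Ct c k \<Rightarrow> k | _ \<Rightarrow> 0") (auto simp: canonical_def marks_def zero)
    then have "M = canonical (q, v)" by (rule ext)
    then show ?thesis by simp
  qed
qed

text \<open>Both markings split down to the same canonical one; the second path is then walked
  backwards.\<close>

lemma marks_convert:
  assumes "marks N M (q, v)" "marks N M' (q, v)" "\<forall>c\<ge>N. v c = 0"
  shows "equivclp (split_step N) M M'"
  using marks_canonical[OF assms(1,3)] marks_canonical[OF assms(2,3)]
  by (meson rtranclp_into_equivclp equivclp_sym equivclp_trans)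

section \<open>Completeness: a word for every run\<close>

lemma count_num_events_high: "k + length bs \<le> k' \<Longrightarrow> count_list (num_events s c k bs) (s', Ct c' k') = 0"
  by (induction bs arbitrary: k) auto

lemma count_vec_events_high:
  "\<forall>(s, n)\<in>set ns. length (bin n) \<le> k' \<Longrightarrow> count_list (vec_events c ns) (s', Ct c' k') = 0"
  by (induction c ns rule: vec_events.induct) (auto simp: count_num_events_high)

lemma count_num_events_sign: "s \<noteq> s' \<Longrightarrow> count_list (num_events s c k bs) (s', w) = 0"
  by (induction bs arbitrary: k) auto

lemma count_conf_events_sign: "s \<noteq> s' \<Longrightarrow> count_list (conf_events s c) (s', w) = 0"
proof -
  assume "s \<noteq> s'"
  then have "count_list (vec_events c (map (Pair s) v)) (s', w) = 0" for c v
    by (induction v arbitrary: c) (auto simp: count_num_events_sign)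
  with \<open>s \<noteq> s'\<close> show ?thesis by (cases c) (auto simp: conf_events_def)
qed

lemma marks_conf_events:
  assumes "\<forall>n\<in>set v. length (bin n) \<le> N"
  shows "marks N (\<lambda>w. count_list (conf_events s (q, v)) (s, w)) (q, vec_of v)"
proof -
  have "count_list (conf_events s (q, v)) (s, Ct c k) = 0" if "N < k" for c k
    using assms that by (fastforce simp: conf_events_def intro!: count_vec_events_high)
  moreover have "(\<Sum>k\<le>N. 2 ^ k * count_list (conf_events s (q, v)) (s, Ct c k)) = vec_of v c" for c
    using weight_conf_events[OF assms, of s q s c] by (simp add: weight_def)
  ultimately show ?thesis by (auto simp: marks_def)
qed

text \<open>Induction along the run from its end. Before each transition the current marking is
  exchanged for one that contains, digit by digit, the tokens the transition consumes.\<close>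

lemma run_formula_complete:
  assumes I: "I \<in> vass_instances"
    and reach: "(vass_step (vass_of I))\<^sup>*\<^sup>* (conf_of (inst_source I)) (conf_of (inst_target I))"
  shows "satisfiable (run_formula I)"
proof -
  let ?N = "length (enc_vass I)" and ?V = "vass_of I"
  obtain qs vs where s: "inst_source I = (qs, vs)" by fastforce
  obtain qt vt where t: "inst_target I = (qt, vt)" by fastforce
  note bounds = bits_bounded[OF I, unfolded s t snd_conv]
  have zero: "\<forall>c\<ge>?N. v c = 0" if "(q, v) \<in> vass_confs ?V" for q v
    using that bounds(4) by (auto simp: vass_confs_def vass_of_def)
  have confs: "conf_of (qs, vs) \<in> vass_confs ?V" "conf_of (qt, vt) \<in> vass_confs ?V"
    using I by (simp_all add: vass_instances_def s t)
  have convert: "\<exists>P. ending I M P" if "marks ?N M (q, v)" "marks ?N M' (q, v)" "(q, v) \<in> vass_confs ?V"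
    "ending I M' P'" for M M' q v P'
    using ending_split[OF marks_convert[OF that(1,2) zero[OF that(3)]] that(4)] .
  have "\<exists>P. ending I M P" if "(vass_step ?V)\<^sup>*\<^sup>* x (conf_of (qt, vt))" "marks ?N M x" for M x
    using that
  proof (induction arbitrary: M rule: converse_rtranclp_induct)
    case base
    \<comment> \<open>Exactly the tokens consumed by the removal of the target, so that firing it
      leaves nothing.\<close>
    let ?M = "\<lambda>w. count_list (conf_events False (qt, vt)) (False, w)"
    have "fire ?M (conf_events False (qt, vt)) (\<lambda>_. 0)"
      using fire_enough[of "conf_events False (qt, vt)" ?M] by (simp add: count_conf_events_sign)
    from ending.target[of _ I, unfolded t, OF this]
    show ?case
      using base confs(2) marks_conf_events[of vt ?N False qt] bounds(2) by (auto simp: conf_of_def intro: convert)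
  next
    case (step x y)
    obtain q v where x: "x = (q, v)" by fastforce
    obtain q' v' where y: "y = (q', v')" by fastforce
    from step.hyps(1) obtain u where u: "(q, u, q') \<in> set (inst_trans I)"
      and xc: "(q, v) \<in> vass_confs ?V" and yc: "(q', v') \<in> vass_confs ?V"
      and add: "\<forall>c\<in>counters ?V. int (v' c) = int (v c) + vec_of u c"
      by (auto simp: vass_step_def x y vass_of_def)
    have v': "int (v' c) = int (v c) + vec_of u c" for c
    proof (cases "c \<in> counters ?V")
      case False
      have "length u = inst_dim I" using I u by (auto simp: vass_instances_def)
      with False xc yc show ?thesis by (auto simp: vass_confs_def vass_of_def vec_of_def)
    qed (use add in blast)
    let ?es = "trans_events (q, u, q')"
    have bits: "\<forall>z\<in>set u. length (bin (nat \<bar>z\<bar>)) \<le> ?N" using bounds(3)[OF u] by blast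
    then have high: "count_list ?es (s, Ct c k) = 0" if "?N < k" for s c k
      using that by (fastforce simp: trans_events_def signed_def intro!: count_vec_events_high)
    \<comment> \<open>What the transition leaves of the old value. \<open>M1\<close> keeps it at
      level 0 beside the tokens to be consumed, \<open>M2\<close> beside those produced.\<close>
    let ?rest = "\<lambda>c. v c - nat (- vec_of u c)"
    define M1 where "M1 w = (case w of St p \<Rightarrow> of_bool (p = q)
      | Ct c k \<Rightarrow> (if k = 0 then ?rest c else 0) + count_list ?es (False, Ct c k))" for w
    define M2 where "M2 w = M1 w + count_list ?es (True, w) - count_list ?es (False, w)" for w
    have fire: "fire M1 ?es M2"
      unfolding M2_def[abs_def] by (rule fire_enough) (auto simp: M1_def split: name.split)
    have M2: "M2 (Ct c k) = (if k = 0 then ?rest c else 0) + count_list ?es (True, Ct c k)"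
      "M2 (St p) = of_bool (p = q')" for c k p
      by (auto simp: M1_def M2_def)
    have sum: "(\<Sum>k\<le>?N. 2 ^ k * ((if k = 0 then ?rest c else 0) + count_list ?es (s, Ct c k))) =
        ?rest c + weight ?N ?es s c" for s c
    proof -
      have "(\<Sum>k\<le>?N. 2 ^ k * ((if k = 0 then ?rest c else 0) + count_list ?es (s, Ct c k))) =
        (\<Sum>k\<le>?N. (if k = 0 then ?rest c else 0) + 2 ^ k * count_list ?es (s, Ct c k))"
        by (intro sum.cong) auto
      then show ?thesis by (simp add: sum.distrib weight_def)
    qed
    \<comment> \<open>The subtraction in \<open>?rest\<close> is not truncated, because
      \<open>v' c\<close> is nonnegative.\<close>
    have "?rest c + nat (- vec_of u c) = v c" "?rest c + nat (vec_of u c) = v' c" for c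
      using v'[of c] by linarith+
    then have "marks ?N M1 (q, v)" "marks ?N M2 (q', v')"
      by (auto simp: marks_def M1_def M2 sum weight_trans_events[OF bits] high)
    moreover from this(2) step.IH obtain P where "ending I M2 P" by (auto simp: y)
    moreover have "?es \<in> set (choices I)" using u by (auto simp: choices_def)
    ultimately show ?case
      using step.prems xc fire by (auto simp: x intro: convert ending.choice)
  qed
  from this[OF reach[unfolded s t], of "\<lambda>w. count_list (conf_events True (qs, vs)) (True, w)"]
  obtain P where "ending I (\<lambda>w. count_list (conf_events True (qs, vs)) (True, w)) P"
    using marks_conf_events[of vs ?N True qs] bounds(1) by (auto simp: conf_of_def)
  moreover have "fire (\<lambda>_. 0) (conf_events True (qs, vs)) (\<lambda>w. count_list (conf_events True (qs, vs)) (True, w))"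
    using fire_enough[of "conf_events True (qs, vs)" "\<lambda>_. 0"] by (simp add: count_conf_events_sign)
  ultimately show ?thesis using ending_satisfiable[of I] by (simp add: s)
qed

theorem theorem3p1:
  shows "polyspace_reducible Reach_VASS SAT_PLRV"
proof -
  obtain M :: "(vsym, fsym) transducer" where M: "transducer M"
    "\<And>x B p cs y. exec x B main_prog (0, \<lambda>_. 0, []) (p, cs, y) \<Longrightarrow> computes_in_space M (Suc B) x y"
    using compile_correct[of main_prog] by blast
  \<comment> \<open>Registers stay at most the input length \<open>n\<close>; the head positions 0
    to \<open>n\<close> take \<open>n + 1\<close> cells, which is the polynomial
    \<open>[:1, 1:]\<close>.\<close>
  have "\<exists>M p. transducer M \<and> (\<forall>I\<in>vass_instances.
      computes_in_space M (poly p (length (enc_vass I))) (enc_vass I) (enc_plrv (run_formula I)))"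
    using M exec_main by (intro exI[of _ M] exI[of _ "[:1, 1:]"]) force
  moreover have "(vass_step (vass_of I))\<^sup>*\<^sup>* (conf_of (inst_source I)) (conf_of (inst_target I)) \<longleftrightarrow>
      satisfiable (run_formula I)" if "I \<in> vass_instances" for I
    using run_formula_complete[OF that] run_formula_sound[OF that] by (auto simp: satisfiable_def)
  ultimately have "polyspace_reduction Reach_VASS SAT_PLRV run_formula"
    unfolding polyspace_reduction_def Reach_VASS_def SAT_PLRV_def by simp
  then show ?thesis
    unfolding polyspace_reducible_def by blast
qed

end
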